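(* Let $B$ be an $\infty$-type bicyclic graph, and let $\Gamma$ and $\Gamma'$ be its two cycles. Then $B$ is unimodular if and only if both of the following conditions hold: (1) $B$ possesses a unique perfect matching; and (2) $B-(\Gamma\cup\Gamma')$ is neither empty nor possesses a perfect matching.
   Context: All graphs are finite, undirected and simple. A connected graph $B$ is bicyclic if $|E(B)|=|V(B)|+1$. A bicyclic graph is called $\infty$-type if its cycles are edge-disjoint (it then has exactly two cycles, sharing at most one vertex). $A(B)$ denotes the $0$-$1$ adjacency matrix of $B$; $B$ is unimodular if $\det A(B)\in\{-1,1\}$. For a subgraph $K$ of $B$, $B-K$ denotes the subgraph of $B$ induced on $V(B)\setminus V(K)$. A graph is empty if it has no vertices. A perfect matching is a spanning subgraph each of whose components is a $K_2$. *)

theory Defs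
  imports "Graph_Theory.Graph_Theory" "Jordan_Normal_Form.Determinant"
begin

text \<open>
  Finite simple undirected graphs are modelled by the locale predicate \<^const>\<open>graph\<close>: finite
  symmetric digraphs without loops and without parallel arcs. Every undirected edge corresponds to
  two opposite arcs. In such a graph the strongly connected components (\<^const>\<open>pre_digraph.sccs\<close>)
  are the connected components, and \<^const>\<open>complete_digraph\<close> is the complete graph.
\<close>

text \<open>
  The digraph notion of a cycle in the library admits the closed walk along an edge and back,
  so cycles are defined here as undirected graphs, with at least three vertices.
\<close>

definition cycle_graph :: "('a, 'b) pre_digraph \<Rightarrow> bool" where
  "cycle_graph C \<longleftrightarrow> graph C \<and>
     (\<exists>xs. distinct xs \<and> 3 \<le> length xs \<and> verts C = set xs \<and>
        arcs_ends C = (\<Union>i<length xs. {(xs ! i, xs ! (Suc i mod length xs)),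
                                        (xs ! (Suc i mod length xs), xs ! i)}))"

definition cycle_of :: "('a, 'b) pre_digraph \<Rightarrow> ('a, 'b) pre_digraph \<Rightarrow> bool" where
  "cycle_of G C \<longleftrightarrow> subgraph C G \<and> cycle_graph C"

definition num_edges :: "('a, 'b) pre_digraph \<Rightarrow> nat" where
  "num_edges G = card (arcs G) div 2"

definition bicyclic :: "('a, 'b) pre_digraph \<Rightarrow> bool" where
  "bicyclic B \<longleftrightarrow> graph B \<and> connected B \<and> num_edges B = card (verts B) + 1"

text \<open>For symmetric subgraphs of one graph, being arc-disjoint is the same as being edge-disjoint.\<close>

definition infinity_type :: "('a, 'b) pre_digraph \<Rightarrow> bool" where
  "infinity_type B \<longleftrightarrow> bicyclic B \<and>
     (\<forall>C D. cycle_of B C \<and> cycle_of B D \<and> C \<noteq> D \<longrightarrow> arcs C \<inter> arcs D = {})"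

text \<open>
  The condition \<^term>\<open>graph M\<close> cannot be dropped, because \<^const>\<open>spanning\<close> also admits
  subdigraphs that contain only one of the two arcs of an edge.
\<close>

definition perfect_matching :: "('a, 'b) pre_digraph \<Rightarrow> ('a, 'b) pre_digraph \<Rightarrow> bool" where
  "perfect_matching G M \<longleftrightarrow> graph M \<and> spanning M G \<and>
     (\<forall>C \<in> pre_digraph.sccs M. complete_digraph 2 C)"

definition graph_minus :: "('a, 'b) pre_digraph \<Rightarrow> ('a, 'b) pre_digraph \<Rightarrow> ('a, 'b) pre_digraph" where
  "graph_minus G K = induce_subgraph G (verts G - verts K)"

definition empty_graph :: "('a, 'b) pre_digraph \<Rightarrow> bool" where
  "empty_graph G \<longleftrightarrow> verts G = {}"

text \<open>
  The rows and columns are ordered by a list \<open>vs\<close> that enumerates the vertices without repetition.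
\<close>

definition adjacency_matrix :: "'a list \<Rightarrow> ('a, 'b) pre_digraph \<Rightarrow> int mat" where
  "adjacency_matrix vs G =
     mat (length vs) (length vs) (\<lambda>(i, j). if (vs ! i, vs ! j) \<in> arcs_ends G then 1 else 0)"

definition unimodular :: "'a list \<Rightarrow> ('a, 'b) pre_digraph \<Rightarrow> bool" where
  "unimodular vs G \<longleftrightarrow> det (adjacency_matrix vs G) \<in> {-1, 1}"

end

theory Submission
  imports Defs "HOL-Combinatorics.Cycles"
begin

text \<open>
  Let \<open>E\<close> be the adjacency relation and \<open>V\<close> the vertex set. The Leibniz expansion of the determinant is the
  sum of the signs of all permutations of \<open>V\<close> that move every vertex along an edge
  (\<open>det_adjacency_matrix\<close>). Among them, the involutions are the perfect matchings. The orbits of the others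
  that have at least three elements are cycles of the graph, turned in one direction. Since the cycles of the
  graph are edge-disjoint and the number of edges exceeds the number of vertices by one only, there are no
  cycles besides \<open>\<Gamma>\<close> and \<open>\<Gamma>'\<close> (\<open>no_three_disjoint_cycles\<close>), and these share at most one vertex
  (\<open>at_most_one_shared_vertex\<close>).

  A permutation and its inverse have the same sign, so the determinant has the parity of the number of
  perfect matchings. If this number is odd, it is one (\<open>odd_matchings_unique\<close>): two perfect matchings differ
  by alternating cycles, so if there are two, they alternate along \<open>\<Gamma>\<close>, say. Because \<open>\<Gamma>\<close> and \<open>\<Gamma>'\<close> have
  no common edge, all perfect matchings then alternate along \<open>\<Gamma>\<close>, and exchanging the two matchings
  of \<open>\<Gamma>\<close> pairs them off.

  Now let the perfect matching be unique. No perfect matching alternates along \<open>\<Gamma>\<close> or \<open>\<Gamma>'\<close>, hence a permutation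
  that is not an involution cannot turn one cycle only: the rest would be matched, the cycle would be even by
  parity, and it could be matched as well. So it turns both cycles, which are then disjoint, and
  matches \<open>B - (\<Gamma> \<union> \<Gamma>')\<close> (\<open>non_involution_structure\<close>). If that graph has no perfect matching, the determinant
  is the sign of the single matching. If it has one, then \<open>\<Gamma>\<close> and \<open>\<Gamma>'\<close> are disjoint
  (\<open>rest_matching_disjoint\<close>): with a common vertex one cycle would be even and the other odd, and the matching
  would extend over the odd cycle without the common vertex to everything outside the even cycle.
  Each of the two cycles can then be turned in two directions, which yields at least three further permutations.
  All permutations of this kind have the same sign (\<open>non_involutions_same_sign\<close>), so the determinant is not
  \<open>\<plusminus>1\<close>. The graph without vertices has a perfect matching, so this case includes the
  one in which \<open>\<Gamma>\<close> and \<open>\<Gamma>'\<close> exhaust \<open>B\<close>.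
\<close>

section \<open>Cycles as lists of vertices\<close>

definition cycle_edges :: "'a list \<Rightarrow> 'a rel" where
  "cycle_edges xs = (\<Union>i<length xs. {(xs ! i, xs ! (Suc i mod length xs)),
                                     (xs ! (Suc i mod length xs), xs ! i)})"

definition is_cycle :: "'a rel \<Rightarrow> 'a list \<Rightarrow> bool" where
  "is_cycle E xs \<longleftrightarrow> distinct xs \<and> 3 \<le> length xs \<and> cycle_edges xs \<subseteq> E"

text \<open>
  Every edge of \<open>R\<close> has the form \<open>x\<close>, \<open>p x\<close>, and \<open>p\<close> moves each vertex of \<open>R\<close> along \<open>R\<close>. If
  \<open>R\<close> is the edge set of a cycle and \<open>p\<close> a permutation, then \<open>p\<close> rotates the cycle by one step in
  one of its two directions.
\<close>
definition traverses :: "('a \<Rightarrow> 'a) \<Rightarrow> 'a rel \<Rightarrow> bool" where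
  "traverses p R \<longleftrightarrow> (\<forall>x y. (x, y) \<in> R \<longleftrightarrow> x \<in> Field R \<and> (y = p x \<or> x = p y))"

lemma sym_cycle_edges: "sym (cycle_edges xs)"
  by (auto simp: cycle_edges_def sym_def)

lemma cycle_edges_nth:
  "i < length xs \<Longrightarrow> (xs ! i, xs ! (Suc i mod length xs)) \<in> cycle_edges xs"
  by (auto simp: cycle_edges_def)

lemma Field_cycle_edges: "Field (cycle_edges xs) = set xs"
proof (intro equalityI subsetI)
  fix x assume "x \<in> Field (cycle_edges xs)"
  then obtain i where "i < length xs" "x = xs ! i \<or> x = xs ! (Suc i mod length xs)"
    by (auto simp: cycle_edges_def Field_def)
  then show "x \<in> set xs"
    by (metis length_pos_if_in_set mod_less_divisor nth_mem)
next
  fix x assume "x \<in> set xs"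
  then obtain i where "i < length xs" "x = xs ! i" by (metis in_set_conv_nth)
  then show "x \<in> Field (cycle_edges xs)"
    using cycle_edges_nth FieldI1 by fast
qed

text \<open>
  A rotation along the list describes the edge set by the vertex set alone. Since a rotated list
  has the same vertices and the same rotation, it also has the same edges, which is how
  the starting point of a cycle is moved below.
\<close>
lemma cycle_edges_conv_rotation:
  assumes "map p xs = rotate1 xs" "inj p"
  shows "cycle_edges xs = {(x, y). x \<in> set xs \<and> (y = p x \<or> x = p y)}"
proof -
  have p: "p (xs ! i) = xs ! (Suc i mod length xs)" if "i < length xs" for i
    using that by (metis assms(1) nth_map nth_rotate1)
  have inv: "y \<in> set xs" if "p y \<in> set xs" for y
  proof -
    have "p ` set xs = set xs" using assms(1) by (metis set_map set_rotate1)
    then show ?thesis using that \<open>inj p\<close> by (metis inj_image_mem_iff)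
  qed
  have "(x, y) \<in> cycle_edges xs \<longleftrightarrow>
        (\<exists>i<length xs. x = xs ! i \<and> y = p (xs ! i) \<or> x = p (xs ! i) \<and> y = xs ! i)" for x y
    unfolding cycle_edges_def using p by fastforce
  also have "\<dots> x y \<longleftrightarrow> (x \<in> set xs \<and> y = p x) \<or> (y \<in> set xs \<and> x = p y)" for x y
    by (metis in_set_conv_nth)
  also have "\<dots> x y \<longleftrightarrow> x \<in> set xs \<and> (y = p x \<or> x = p y)" for x y
    using inv Field_cycle_edges p
    by (metis assms(1) image_eqI list.set_map set_rotate1)
  finally show ?thesis by auto
qed

lemma traverses_if_rotation:
  assumes "map p xs = rotate1 xs" "inj p"
  shows "traverses p (cycle_edges xs)"
  unfolding traverses_def Field_cycle_edges using cycle_edges_conv_rotation[OF assms] by auto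

lemma ex_rotation:
  assumes "distinct xs"
  obtains c where "c permutes set xs" "map c xs = rotate1 xs"
  using cyclic_rotation[OF assms, of 1] cycle_permutes[of xs] that by auto

lemma cycle_edges_rotate:
  assumes "distinct xs"
  shows "cycle_edges (rotate k xs) = cycle_edges xs"
proof -
  obtain c where c: "c permutes set xs" "map c xs = rotate1 xs" using ex_rotation[OF assms] .
  have "map c (rotate k xs) = rotate1 (rotate k xs)"
    using c(2) by (metis rotate1_rotate_swap rotate_map)
  from cycle_edges_conv_rotation[OF this permutes_inj[OF c(1)]]
  show ?thesis
    using cycle_edges_conv_rotation[OF c(2) permutes_inj[OF c(1)]] by simp
qed

lemma rotate_to_front:
  assumes "distinct xs" "u \<in> set xs"
  obtains ys where "distinct (u # ys)" "set (u # ys) = set xs" "length (u # ys) = length xs"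
    "cycle_edges (u # ys) = cycle_edges xs"
proof -
  obtain as bs where xs: "xs = as @ u # bs" using assms(2) by (meson split_list)
  have "rotate (length as) xs = (u # bs) @ as" unfolding xs by (metis rotate_append)
  then have "cycle_edges (u # bs @ as) = cycle_edges xs"
    using cycle_edges_rotate[OF assms(1), of "length as"] by simp
  then show ?thesis using that[of "bs @ as"] assms(1) xs by auto
qed

lemma is_cycle_rotate_to_front:
  assumes "is_cycle E xs" "u \<in> set xs"
  obtains ys where "is_cycle E (u # ys)" "set (u # ys) = set xs" "length (u # ys) = length xs"
    "cycle_edges (u # ys) = cycle_edges xs"
  using assms rotate_to_front[of xs u] unfolding is_cycle_def by metis

lemma successively_cycle_edges:
  "successively (\<lambda>x y. (x, y) \<in> cycle_edges (a # xs)) (a # xs @ [a])"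
  unfolding successively_conv_nth
proof (intro allI impI)
  fix i assume i: "Suc i < length (a # xs @ [a])"
  have "(a # xs @ [a]) ! i = (a # xs) ! i"
    using i by (auto simp: nth_Cons nth_append split: nat.splits)
  moreover have "(a # xs @ [a]) ! Suc i = (a # xs) ! (Suc i mod length (a # xs))"
    using i by (cases "i = length xs") (auto simp: nth_append)
  ultimately show "((a # xs @ [a]) ! i, (a # xs @ [a]) ! Suc i) \<in> cycle_edges (a # xs)"
    using i cycle_edges_nth[of i "a # xs"] by simp
qed

lemma cycle_edges_subset_if_successively:
  assumes "successively (\<lambda>x y. (x, y) \<in> E) (a # xs @ [a])" "sym E"
  shows "cycle_edges (a # xs) \<subseteq> E"
proof -
  have "((a # xs) ! i, (a # xs) ! (Suc i mod length (a # xs))) \<in> E" if "i < length (a # xs)" for i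
  proof -
    have "(a # xs @ [a]) ! i = (a # xs) ! i"
      using that by (auto simp: nth_Cons nth_append split: nat.splits)
    moreover have "(a # xs @ [a]) ! Suc i = (a # xs) ! (Suc i mod length (a # xs))"
      using that by (cases "i = length xs") (auto simp: nth_append)
    ultimately show ?thesis using successively_nth[OF assms(1), of i] that by simp
  qed
  then show ?thesis using \<open>sym E\<close> unfolding cycle_edges_def by (blast dest: symD)
qed

lemma traverses_edge:
  assumes "traverses p R" "x \<in> Field R"
  shows "(x, p x) \<in> R" "p x \<in> Field R"
proof -
  show *: "(x, p x) \<in> R" using assms unfolding traverses_def by blast
  show "p x \<in> Field R" using * by (rule FieldI2)
qed

text \<open>
  On a cycle with at least three vertices the two neighbours of a vertex are distinct; this is
  what separates the long orbits of a permutation from the matched pairs.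
\<close>
lemma traverses_involution_free:
  assumes "traverses p (cycle_edges xs)" "inj p" "distinct xs" "3 \<le> length xs" "x \<in> set xs"
  shows "p (p x) \<noteq> x"
proof
  assume pp: "p (p x) = x"
  obtain c where c: "c permutes set xs" "map c xs = rotate1 xs" using ex_rotation[OF assms(3)] .
  have tc: "traverses c (cycle_edges xs)" using c traverses_if_rotation permutes_inj by blast
  obtain i where i: "i < length xs" "x = xs ! i" using assms(5) by (metis in_set_conv_nth)
  have c_nth: "c (xs ! j) = xs ! (Suc j mod length xs)" if "j < length xs" for j
    using that c(2) by (metis nth_map nth_rotate1)
  define y where "y = inv_into UNIV c x"
  have y: "c y = x" using c(1) by (simp add: y_def permutes_inverses)
  have "y \<in> set xs" using y assms(5) c(1) by (metis permutes_in_image)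
  have ne: "c x \<noteq> y"
  proof
    assume "c x = y"
    then have "c (c x) = x" using y by simp
    moreover have "c (c x) = xs ! (Suc (Suc i mod length xs) mod length xs)"
      using i c_nth by (metis length_pos_if_in_set assms(5) mod_less_divisor)
    ultimately have "Suc (Suc i mod length xs) mod length xs = i"
      using i assms(3) nth_eq_iff_index_eq by (metis mod_less_divisor length_pos_if_in_set assms(5))
    then show False using i(1) assms(4) by (auto simp: mod_Suc split: if_splits)
  qed
  have "(x, c x) \<in> cycle_edges xs" "(x, y) \<in> cycle_edges xs"
    using tc y assms(5) by (auto simp: traverses_def Field_cycle_edges)
  then have 1: "c x = p x \<or> x = p (c x)" and 2: "y = p x \<or> x = p y"
    using assms(1) unfolding traverses_def by auto
  then show False using ne pp \<open>inj p\<close> unfolding inj_def by metis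
qed

section \<open>Permutations along edges\<close>

text \<open>
  These permutations index the nonzero terms in the Leibniz expansion of the determinant of an
  adjacency matrix.
\<close>
definition adj_perms :: "'a rel \<Rightarrow> 'a set \<Rightarrow> ('a \<Rightarrow> 'a) set" where
  "adj_perms E V = {p. p permutes V \<and> (\<forall>v\<in>V. (v, p v) \<in> E)}"

text \<open>
  A perfect matching of the graph induced on \<open>V\<close>, given as the map that sends each vertex to its
  partner. Outside \<open>V\<close> it is the identity, so each matching is represented by exactly one function and
  matchings of disjoint vertex sets are glued by composition.
\<close>
definition matchings :: "'a rel \<Rightarrow> 'a set \<Rightarrow> ('a \<Rightarrow> 'a) set" where
  "matchings E V = {p \<in> adj_perms E V. \<forall>v. p (p v) = v}"

lemma adj_permsD:
  assumes "p \<in> adj_perms E V"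
  shows "p permutes V" "v \<in> V \<Longrightarrow> (v, p v) \<in> E"
  using assms by (auto simp: adj_perms_def)

lemma matchingsD:
  assumes "M \<in> matchings E V"
  shows "M \<in> adj_perms E V" "M permutes V" "v \<in> V \<Longrightarrow> (v, M v) \<in> E" "M (M v) = v"
    "M v \<in> V \<longleftrightarrow> v \<in> V"
  using assms by (auto simp: matchings_def adj_perms_def permutes_in_image)

lemma matchingsI:
  assumes "\<And>v. v \<in> V \<Longrightarrow> M v \<in> V \<and> (v, M v) \<in> E \<and> M (M v) = v" "\<And>v. v \<notin> V \<Longrightarrow> M v = v"
  shows "M \<in> matchings E V"
proof -
  have inv: "M (M v) = v" for v using assms by (cases "v \<in> V") auto
  have "bij_betw M V V" by (rule bij_betw_byWitness[where f' = M]) (use assms(1) inv in auto)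
  then have "M permutes V" using assms(2) by (rule bij_imp_permutes)
  then show ?thesis using assms(1) inv by (simp add: matchings_def adj_perms_def)
qed

lemma adj_perms_mono: "E \<subseteq> F \<Longrightarrow> adj_perms E V \<subseteq> adj_perms F V"
  by (auto simp: adj_perms_def)

lemma matchings_mono: "E \<subseteq> F \<Longrightarrow> matchings E V \<subseteq> matchings F V"
  using adj_perms_mono[of E F V] by (auto simp: matchings_def)

lemma finite_adj_perms: "finite V \<Longrightarrow> finite (adj_perms E V)"
  unfolding adj_perms_def by (rule finite_subset[OF _ finite_permutations[of V]]) auto

lemma finite_matchings: "finite V \<Longrightarrow> finite (matchings E V)"
  unfolding matchings_def using finite_adj_perms[of V E] by simp

lemma inv_adj_perms:
  assumes "p \<in> adj_perms E V" "sym E"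
  shows "inv_into UNIV p \<in> adj_perms E V"
proof -
  note p = adj_permsD(1)[OF assms(1)]
  have "(v, inv_into UNIV p v) \<in> E" if "v \<in> V" for v
  proof -
    have "inv_into UNIV p v \<in> V" using p that permutes_inv permutes_in_image by fastforce
    then have "(inv_into UNIV p v, v) \<in> E"
      using adj_permsD(2)[OF assms(1)] p permutes_inverses(1) by metis
    then show ?thesis using \<open>sym E\<close> by (simp add: symD)
  qed
  then show ?thesis using p permutes_inv by (auto simp: adj_perms_def)
qed

lemma compose_disjoint:
  assumes "p permutes A" "q permutes B" "A \<inter> B = {}"
  shows "v \<in> A \<Longrightarrow> (p \<circ> q) v = p v" "v \<notin> A \<Longrightarrow> (p \<circ> q) v = q v"
proof -
  show "(p \<circ> q) v = p v" if "v \<in> A"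
    using that assms by (metis comp_apply disjoint_iff permutes_not_in)
  show "(p \<circ> q) v = q v" if "v \<notin> A"
  proof (cases "v \<in> B")
    case True
    then have "q v \<in> B" using assms(2) by (simp add: permutes_in_image)
    then show ?thesis using assms by (metis comp_apply disjoint_iff permutes_not_in)
  next
    case False
    then show ?thesis using assms that by (simp add: permutes_not_in)
  qed
qed

lemma compose_adj_perms:
  assumes "p \<in> adj_perms E A" "q \<in> adj_perms E B" "A \<inter> B = {}"
  shows "p \<circ> q \<in> adj_perms E (A \<union> B)"
proof -
  note pq = adj_permsD(1)[OF assms(1)] adj_permsD(1)[OF assms(2)]
  have "p \<circ> q permutes (A \<union> B)"
    using pq by (meson permutes_compose permutes_subset sup_ge1 sup_ge2)
  moreover have "(v, (p \<circ> q) v) \<in> E" if "v \<in> A \<union> B" for v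
    using that compose_disjoint[OF pq assms(3), of v] adj_permsD(2) assms(1,2) by fastforce
  ultimately show ?thesis by (simp add: adj_perms_def)
qed

lemma compose_matchings:
  assumes "M \<in> matchings E A" "N \<in> matchings E B" "A \<inter> B = {}"
  shows "M \<circ> N \<in> matchings E (A \<union> B)"
proof -
  note MN = matchingsD(2)[OF assms(1)] matchingsD(2)[OF assms(2)]
  have "(M \<circ> N) ((M \<circ> N) v) = v" for v
  proof (cases "v \<in> A")
    case True
    then show ?thesis using compose_disjoint(1)[OF MN assms(3)] matchingsD(4,5)[OF assms(1)] by metis
  next
    case False
    then have "N v \<notin> A"
      using assms(3) MN(2) matchingsD(5)[OF assms(2)] by (metis disjoint_iff permutes_not_in)
    then show ?thesis using False compose_disjoint(2)[OF MN assms(3)] matchingsD(4)[OF assms(2)] by metis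
  qed
  then show ?thesis
    using compose_adj_perms[OF matchingsD(1)[OF assms(1)] matchingsD(1)[OF assms(2)] assms(3)]
    by (simp add: matchings_def)
qed

lemma permutes_image_if_closed:
  assumes "p permutes V" "finite X" "\<And>x. x \<in> X \<Longrightarrow> p x \<in> X"
  shows "p ` X = X" "p v \<in> X \<longleftrightarrow> v \<in> X"
proof -
  have "inj_on p X" using assms(1) by (meson permutes_inj_on)
  then show *: "p ` X = X" using assms(2,3) by (simp add: endo_inj_surj image_subsetI)
  show "p v \<in> X \<longleftrightarrow> v \<in> X" using * assms(1) by (metis inj_image_mem_iff permutes_inj)
qed

lemma restrict_matching:
  assumes "p \<in> adj_perms E V" "finite V" "X \<subseteq> V" "\<And>x. x \<in> X \<Longrightarrow> p x \<in> X"
    and "\<And>v. v \<in> V - X \<Longrightarrow> p (p v) = v"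
  shows "restrict_id p (V - X) \<in> matchings E (V - X)"
proof (rule matchingsI)
  fix v assume v: "v \<in> V - X"
  have "finite X" using assms(2,3) finite_subset by blast
  then have "p v \<in> V - X"
    using v permutes_image_if_closed(2)[OF adj_permsD(1)[OF assms(1)] _ assms(4), where v = v]
      adj_permsD(1)[OF assms(1)] permutes_in_image by fastforce
  then show "restrict_id p (V - X) v \<in> V - X \<and> (v, restrict_id p (V - X) v) \<in> E \<and>
      restrict_id p (V - X) (restrict_id p (V - X) v) = v"
    using v assms(5) adj_permsD(2)[OF assms(1)] by (auto simp: restrict_id_def)
qed (auto simp: restrict_id_def)

text \<open>
  The orbits of a fixed-point-free involution are pairs.
\<close>
lemma even_card_if_involution:
  assumes "finite A" "\<And>x. x \<in> A \<Longrightarrow> f x \<in> A \<and> f x \<noteq> x \<and> f (f x) = x"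
  shows "even (card A)"
  using assms
proof (induction "card A" arbitrary: A rule: less_induct)
  case less
  show ?case
  proof (cases "A = {}")
    case False
    then obtain a where a: "a \<in> A" by auto
    define B where "B = A - {a, f a}"
    have "a \<notin> B" "f a \<notin> insert a B" "finite B" "A = insert (f a) (insert a B)"
      using a less.prems unfolding B_def by auto
    then have card: "card A = card B + 2" by simp
    moreover have "even (card B)"
    proof (rule less.hyps)
      show "finite B" using less.prems by (simp add: B_def)
      fix x assume "x \<in> B"
      then show "f x \<in> B \<and> f x \<noteq> x \<and> f (f x) = x"
        using less.prems(2)[of x] less.prems(2)[of a] a unfolding B_def by auto
    qed (use card in auto)
    ultimately show ?thesis by simp
  qed simp
qed

lemma even_card_if_matching:
  assumes "M \<in> matchings E V" "finite V" "irrefl E"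
  shows "even (card V)"
proof (rule even_card_if_involution[where f = M])
  show "M x \<in> V \<and> M x \<noteq> x \<and> M (M x) = x" if "x \<in> V" for x
    using that matchingsD[OF assms(1)] assms(3) by (metis irreflD)
qed fact

lemma matching_of_path:
  assumes "even (length zs)" "distinct zs" "sym R" "successively (\<lambda>x y. (x, y) \<in> R) zs"
  shows "matchings R (set zs) \<noteq> {}"
  using assms
proof (induction zs rule: induct_list012)
  case 1
  have "id \<in> matchings R {}" by (rule matchingsI) auto
  then show ?case by auto
next
  case (3 a b zs)
  have "successively (\<lambda>x y. (x, y) \<in> R) zs"
    using 3(6) by (auto simp: successively_Cons)
  then obtain M where M: "M \<in> matchings R (set zs)" using 3 by auto
  have "Transposition.transpose a b \<in> matchings R {a, b}"
    by (rule matchingsI) (use 3 in \<open>auto simp: transpose_def dest: symD\<close>)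
  then have "Transposition.transpose a b \<circ> M \<in> matchings R ({a, b} \<union> set zs)"
    using M 3(4) by (intro compose_matchings) auto
  then show ?case by auto
qed auto

lemma matching_of_even_cycle:
  assumes "distinct xs" "even (length xs)"
  shows "matchings (cycle_edges xs) (set xs) \<noteq> {}"
proof (rule matching_of_path)
  show "successively (\<lambda>x y. (x, y) \<in> cycle_edges xs) xs"
  proof (cases xs)
    case (Cons a as)
    then show ?thesis
      using successively_cycle_edges[of a as] successively_append_iff[of _ "a # as" "[a]"] by simp
  qed simp
qed (use assms sym_cycle_edges in auto)

text \<open>
  Deleting a vertex leaves a path with an even number of vertices.
\<close>
lemma matching_of_odd_cycle_minus_vertex:
  assumes "distinct xs" "odd (length xs)" "u \<in> set xs"
  shows "matchings (cycle_edges xs) (set xs - {u}) \<noteq> {}"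
proof -
  obtain ys where ys: "distinct (u # ys)" "set (u # ys) = set xs" "length (u # ys) = length xs"
    "cycle_edges (u # ys) = cycle_edges xs" using rotate_to_front[OF assms(1,3)] .
  have "successively (\<lambda>x y. (x, y) \<in> cycle_edges xs) ys"
    using successively_cycle_edges[of u ys] ys(4)
    by (auto simp: successively_Cons successively_append_iff)
  then have "matchings (cycle_edges xs) (set ys) \<noteq> {}"
    using ys(1) ys(3)[symmetric] assms(2) by (intro matching_of_path) (auto simp: sym_cycle_edges)
  moreover have "set ys = set xs - {u}" using ys by auto
  ultimately show ?thesis by simp
qed

section \<open>Exchanging the two perfect matchings of an even cycle\<close>

text \<open>
  On \<open>X\<close>, the partner of a vertex is replaced by its other neighbour with respect to the rotation
  \<open>c\<close>. The inverse is written with \<open>inv_into\<close> because \<open>inv\<close> denotes the inverse in an abstract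
  group here.
\<close>
definition toggle :: "('a \<Rightarrow> 'a) \<Rightarrow> 'a set \<Rightarrow> ('a \<Rightarrow> 'a) \<Rightarrow> 'a \<Rightarrow> 'a" where
  "toggle c X M v = (if v \<in> X then if M v = c v then inv_into UNIV c v else c v else M v)"

text \<open>
  A matching that stays on the cycle at every vertex of the cycle uses every other edge of it,
  and the remaining cycle edges form another such matching. Hence toggling is a
  fixed-point-free involution on these matchings.
\<close>
lemma toggle_matching:
  assumes cycle: "is_cycle E xs" and c: "c permutes set xs" "map c xs = rotate1 xs"
    and M: "M \<in> matchings E V" "\<And>x. x \<in> set xs \<Longrightarrow> (x, M x) \<in> cycle_edges xs" and "set xs \<subseteq> V"
  shows "toggle c (set xs) M \<in> matchings E V"
    and "\<And>x. x \<in> set xs \<Longrightarrow> (x, toggle c (set xs) M x) \<in> cycle_edges xs"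
    and "toggle c (set xs) (toggle c (set xs) M) = M"
    and "x \<in> set xs \<Longrightarrow> toggle c (set xs) M x \<noteq> M x"
proof -
  let ?X = "set xs" and ?T = "toggle c (set xs) M"
  have dist: "distinct xs" "3 \<le> length xs" and sub: "cycle_edges xs \<subseteq> E"
    using cycle by (auto simp: is_cycle_def)
  have edges: "cycle_edges xs = {(x, y). x \<in> ?X \<and> (y = c x \<or> x = c y)}"
    by (rule cycle_edges_conv_rotation[OF c(2) permutes_inj[OF c(1)]])
  have cc: "c (c x) \<noteq> x" if "x \<in> ?X" for x
    using traverses_involution_free[OF traverses_if_rotation[OF c(2)] _ dist that] permutes_inj[OF c(1)]
    by auto
  have ic: "c (inv_into UNIV c x) = x" "inv_into UNIV c (c x) = x" for x using c(1) by (simp_all add: permutes_inverses)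
  have X: "c x \<in> ?X \<longleftrightarrow> x \<in> ?X" "inv_into UNIV c x \<in> ?X \<longleftrightarrow> x \<in> ?X" for x
    using c(1) permutes_inv[OF c(1)] by (simp_all add: permutes_in_image)
  have Mx: "M x = c x \<or> M x = inv_into UNIV c x" if "x \<in> ?X" for x
    using M(2)[OF that] edges ic by auto metis
  have ne: "inv_into UNIV c x \<noteq> c x" if "x \<in> ?X" for x
    using cc[OF that] ic by (metis)
  have MX: "M x \<in> ?X \<longleftrightarrow> x \<in> ?X" for x
    using Mx X matchingsD(4)[OF M(1)] by metis
  have MM: "M (M x) = x" for x using matchingsD(4)[OF M(1)] .
  show edge: "(x, ?T x) \<in> cycle_edges xs" if "x \<in> ?X" for x
    using that ic by (auto simp: toggle_def edges)
  have TX: "?T x \<in> ?X" if "x \<in> ?X" for x using that X by (simp add: toggle_def)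
  have TT: "?T (?T x) = x" if "x \<in> ?X" for x
  proof (cases "M x = c x")
    case True
    have "M (inv_into UNIV c x) \<noteq> x" using True MM ne[OF that] by metis
    then show ?thesis using that True ic X by (simp add: toggle_def)
  next
    case False
    then have "M x = inv_into UNIV c x" using Mx that by blast
    then have "M (c x) \<noteq> x" using MM False by metis
    then have "M (c x) = c (c x)" using Mx[of "c x"] X ic that by auto
    then show ?thesis using that False ic X by (simp add: toggle_def)
  qed
  show "?T \<in> matchings E V"
  proof (rule matchingsI)
    fix v assume v: "v \<in> V"
    show "?T v \<in> V \<and> (v, ?T v) \<in> E \<and> ?T (?T v) = v"
    proof (cases "v \<in> ?X")
      case True
      then show ?thesis using edge[OF True] sub TX[OF True] TT[OF True] assms(6) by auto
    next
      case False
      then have "?T v = M v" "?T (M v) = v" using MX MM by (simp_all add: toggle_def)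
      then show ?thesis using v matchingsD[OF M(1)] by simp
    qed
  next
    fix v assume "v \<notin> V"
    then show "?T v = v" using assms(6) matchingsD(2)[OF M(1)]
      by (auto simp: toggle_def permutes_not_in)
  qed
  show "toggle c ?X ?T = M"
  proof
    fix v show "toggle c ?X ?T v = M v"
      using Mx[of v] ne[of v] by (auto simp: toggle_def)
  qed
  show "?T x \<noteq> M x" if "x \<in> ?X" using Mx[OF that] ne[OF that] that by (auto simp: toggle_def)
qed

section \<open>Orbits and alternating cycles\<close>

text \<open>
  The orbit of \<open>v\<close>, listed from \<open>v\<close> on, is mapped to its rotation. It has at least three elements
  because \<open>p\<close> neither fixes \<open>v\<close> nor exchanges it with \<open>p v\<close>.
\<close>
lemma orbit_cycle:
  assumes p: "p permutes V" "finite V" and v: "p v \<noteq> v" "p (p v) \<noteq> v"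
  obtains zs where "distinct zs" "3 \<le> length zs" "v \<in> set zs" "map p zs = rotate1 zs"
proof -
  have perm: "permutation p" using p permutation_permutes by blast
  define d where "d = least_power p v"
  define zs where "zs = map (\<lambda>i. (p ^^ i) v) [0..<d]"
  have d: "(p ^^ d) v = v" "d > 0"
    using least_power_of_permutation[OF perm] by (simp_all add: d_def)
  have "d \<noteq> 1" "d \<noteq> 2" using d v by (auto simp: numeral_2_eq_2)
  then have d3: "3 \<le> d" using d(2) by linarith
  have "map p zs = rotate1 zs"
  proof (rule nth_equalityI)
    fix i assume "i < length (map p zs)"
    then have i: "i < d" by (simp add: zs_def)
    have "rotate1 zs ! i = (p ^^ (Suc i mod d)) v"
      using i d(2) by (simp add: zs_def nth_rotate1)
    also have "\<dots> = (p ^^ Suc i) v" using i d by (cases "Suc i = d") auto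
    finally show "map p zs ! i = rotate1 zs ! i" using i by (simp add: zs_def)
  qed (simp add: zs_def)
  moreover have "distinct zs"
    using cycle_of_permutation[OF perm] by (simp add: zs_def d_def)
  moreover have "v \<in> set zs" using d(2) by (force simp: zs_def)
  ultimately show ?thesis using that d3 by (simp add: zs_def)
qed

lemma orbit_is_cycle:
  assumes p: "p \<in> adj_perms E V" "finite V" "sym E" and v: "p v \<noteq> v" "p (p v) \<noteq> v"
  obtains zs where "is_cycle E zs" "v \<in> set zs" "traverses p (cycle_edges zs)" "set zs \<subseteq> V"
proof -
  note perm = adj_permsD(1)[OF p(1)]
  obtain zs where zs: "distinct zs" "3 \<le> length zs" "v \<in> set zs" "map p zs = rotate1 zs"
    using orbit_cycle[OF perm p(2) v] .
  have inj: "inj p" using perm by (rule permutes_inj)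
  have tr: "traverses p (cycle_edges zs)" by (rule traverses_if_rotation[OF zs(4) inj])
  have sub: "set zs \<subseteq> V"
  proof
    fix x assume "x \<in> set zs"
    then have "p (p x) \<noteq> x" using traverses_involution_free[OF tr inj zs(1,2)] by simp
    then show "x \<in> V" using perm by (metis permutes_not_in)
  qed
  have "cycle_edges zs \<subseteq> E"
  proof (clarify)
    fix x y assume "(x, y) \<in> cycle_edges zs"
    then have xy: "y = p x \<or> x = p y" "x \<in> set zs" "y \<in> set zs"
      using tr Field_cycle_edges[of zs] FieldI1 FieldI2 unfolding traverses_def by fast+
    then have "(x, p x) \<in> E" "(y, p y) \<in> E" using sub adj_permsD(2)[OF p(1)] by auto
    then show "(x, y) \<in> E" using xy(1) \<open>sym E\<close> by (auto dest: symD)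
  qed
  then show ?thesis using that[of zs] zs tr sub by (simp add: is_cycle_def)
qed

text \<open>
  The union of two perfect matchings is bipartite: its components are single edges and cycles whose
  edges alternate between the two matchings. The colour classes are obtained from the orbits of
  \<open>K \<circ> M\<close>, each of which contains every other vertex of a component.
\<close>
lemma matchings_two_colouring:
  assumes M: "M \<in> matchings E V" and K: "K \<in> matchings E V" and "finite V" "irrefl E"
  shows "\<exists>f. \<forall>v\<in>V. f (M v) = (\<not> f v) \<and> f (K v) = (\<not> f v)"
proof -
  define q where "q = K \<circ> M"
  have MM: "M (M v) = v" and KK: "K (K v) = v" for v
    using matchingsD(4)[OF M] matchingsD(4)[OF K] by auto
  have fixfree: "M v \<noteq> v" "K v \<noteq> v" if "v \<in> V" for v
    using that matchingsD(3)[OF M] matchingsD(3)[OF K] \<open>irrefl E\<close> by (metis irreflD)+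
  have V: "M v \<in> V \<longleftrightarrow> v \<in> V" "K v \<in> V \<longleftrightarrow> v \<in> V" for v
    using matchingsD(5)[OF M] matchingsD(5)[OF K] by auto
  have qp: "q permutes V"
    unfolding q_def using permutes_compose matchingsD(2) M K by blast
  obtain n where n: "q ^^ n = id" "n > 0"
    using permutation_is_nilpotent qp \<open>finite V\<close> permutation_permutes by blast
  define cl where "cl v = range (\<lambda>k. (q ^^ k) v)" for v
  have clI: "(q ^^ k) v \<in> cl v" for k v by (simp add: cl_def)
  have cl_sub: "cl w \<subseteq> cl v" if w: "w \<in> cl v" for v w
  proof
    fix x assume "x \<in> cl w"
    then obtain i j where "x = (q ^^ i) w" "w = (q ^^ j) v" using w by (auto simp: cl_def)
    then show "x \<in> cl v" using clI[of "i + j" v] by (simp add: funpow_add)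
  qed
  have cl_sym: "v \<in> cl w" if w: "w \<in> cl v" for v w
  proof -
    obtain k where k: "w = (q ^^ k) v" using w by (auto simp: cl_def)
    have "(q ^^ (n * k - k)) w = (q ^^ (n * k - k + k)) v" by (simp add: k funpow_add)
    also have "\<dots> = ((q ^^ n) ^^ k) v" using n(2) by (simp add: funpow_mult)
    finally show ?thesis using n(1) clI[of "n * k - k" w] by simp
  qed
  have cl_eq: "cl w = cl v" if "w \<in> cl v" for v w
    using cl_sub[OF that] cl_sub[OF cl_sym[OF that]] by blast
  \<comment> \<open>\<open>M\<close> conjugates \<open>q\<close> to its inverse, so an orbit of \<open>q\<close> that \<open>M\<close> maps to itself would
      contain a fixed point of \<open>M\<close> or of \<open>K\<close>.\<close>
  have qMq: "q (M (q u)) = M u" for u by (simp add: q_def MM KK)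
  have conj: "(q ^^ k) (M ((q ^^ k) v)) = M v" for k v
  proof (induction k arbitrary: v)
    case (Suc k)
    have "(q ^^ Suc k) (M ((q ^^ Suc k) v)) = (q ^^ k) (q (M (q ((q ^^ k) v))))"
      by (simp add: funpow_swap1)
    also have "\<dots> = M v" using Suc by (simp only: qMq)
    finally show ?case .
  qed simp
  have inj: "inj (q ^^ j)" for j
    using permutes_inj[OF permutes_funpow[OF qp]] .
  have cl_M: "cl (M v) \<noteq> cl v" if "v \<in> V" for v
  proof
    assume "cl (M v) = cl v"
    then have "M v \<in> cl v" using clI[of 0 "M v"] by simp
    then obtain k where k: "M v = (q ^^ k) v" by (auto simp: cl_def)
    have "\<exists>j. k = j + j \<or> k = j + Suc j" by presburger
    then obtain j where j: "k = j + j \<or> k = j + Suc j" ..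
    define u where "u = (q ^^ j) v"
    have u: "u \<in> V" using that permutes_in_image[OF permutes_funpow[OF qp]] by (simp add: u_def)
    have "(q ^^ j) (M u) = (q ^^ k) v" unfolding u_def k[symmetric] by (rule conj)
    then have "(q ^^ j) (M u) = (q ^^ j) u \<or> (q ^^ j) (M u) = (q ^^ j) (q u)"
      using j by (auto simp: funpow_add u_def funpow_swap1)
    then have "M u = u \<or> M u = q u" using injD[OF inj] by blast
    then show False using fixfree(1)[OF u] fixfree(2)[of "M u"] u V by (auto simp: q_def)
  qed
  have cl_K: "cl (K v) = cl (M v)" for v
    using cl_eq[of "K v" "M v"] clI[of 1 "M v"] by (simp add: q_def MM)
  have cl_MK: "cl (M (K v)) = cl v" for v
    using cl_eq[of v "M (K v)"] clI[of 1 "M (K v)"] by (simp add: q_def MM KK)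
  \<comment> \<open>The alternating component of \<open>v\<close> is the union of the orbits of \<open>v\<close> and \<open>M v\<close>; colour one of
      the two.\<close>
  define f where "f v \<longleftrightarrow> cl v = (SOME c. c \<in> {cl v, cl (M v)})" for v
  have some: "(SOME c. c \<in> {a, b}) = a \<or> (SOME c. c \<in> {a, b}) = b" for a b :: "'a set"
    using someI[of "\<lambda>c. c \<in> {a, b}" a] by auto
  have fM: "f (M v) = (\<not> f v)" if "v \<in> V" for v
    using cl_M[OF that] some[of "cl v" "cl (M v)"]
    by (auto simp: f_def MM insert_commute)
  have fK: "f (K v) = f (M v)" for v
    by (simp add: f_def cl_K cl_MK MM)
  show ?thesis by (rule exI[of _ f]) (simp add: fM fK)
qed

text \<open>
  With a proper 2-colouring of the union of \<open>M\<close> and \<open>K\<close>, follow \<open>M\<close> from one colour and \<open>K\<close> from the other.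
  This is a permutation along edges whose orbit through \<open>v\<close> is the alternating
  cycle through \<open>v\<close>.
\<close>
lemma alternating_cycle:
  assumes M: "M \<in> matchings E V" and K: "K \<in> matchings E V"
    and "finite V" "sym E" "irrefl E" and ne: "M v \<noteq> K v"
  obtains zs where "is_cycle E zs" "v \<in> set zs" "set zs \<subseteq> V"
    "\<And>x. x \<in> set zs \<Longrightarrow> (x, M x) \<in> cycle_edges zs \<and> (x, K x) \<in> cycle_edges zs"
proof -
  obtain f where f: "\<forall>v\<in>V. f (M v) = (\<not> f v) \<and> f (K v) = (\<not> f v)"
    using matchings_two_colouring[OF M K \<open>finite V\<close> \<open>irrefl E\<close>] ..
  note MD = matchingsD[OF M] and KD = matchingsD[OF K]
  have v: "v \<in> V"
  proof (rule ccontr)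
    assume "v \<notin> V"
    then have "M v = v" "K v = v" by (rule permutes_not_in[OF MD(2)], rule permutes_not_in[OF KD(2)])
    then show False using ne by simp
  qed
  \<comment> \<open>The values of \<open>p'\<close> are those of the inverse of \<open>p\<close>.\<close>
  define p where "p u = (if f u then M u else K u)" for u
  define p' where "p' u = (if f u then K u else M u)" for u
  have pp': "p (p' u) = u \<and> p' (p u) = u \<and> p u \<in> V \<and> p' u \<in> V" if "u \<in> V" for u
    using bspec[OF f that] that by (simp add: p_def p'_def MD(4,5) KD(4,5))
  have "bij_betw p V V" by (rule bij_betw_byWitness[where f' = p']) (use pp' in blast)+
  moreover have "p u = u" if "u \<notin> V" for u
    using that permutes_not_in[OF MD(2)] permutes_not_in[OF KD(2)] by (simp add: p_def)
  ultimately have "p permutes V" by (rule bij_imp_permutes)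
  then have pE: "p \<in> adj_perms E V" using MD(3) KD(3) by (simp add: adj_perms_def p_def)
  have "(v, p v) \<in> E" using pE v by (rule adj_permsD(2))
  then have pv: "p v \<noteq> v" using \<open>irrefl E\<close> by (auto dest: irreflD)
  have "p (p v) = (if f v then K (M v) else M (K v))" using bspec[OF f v] by (simp add: p_def)
  then have ppv: "p (p v) \<noteq> v" using ne MD(4)[of v] KD(4)[of v] MD(4)[of "K v"] KD(4)[of "M v"]
    by (metis (full_types))
  obtain zs where zs: "is_cycle E zs" "v \<in> set zs" "traverses p (cycle_edges zs)"
    "set zs \<subseteq> V" using orbit_is_cycle[OF pE \<open>finite V\<close> \<open>sym E\<close> pv ppv] .
  have "(x, M x) \<in> cycle_edges zs \<and> (x, K x) \<in> cycle_edges zs" if "x \<in> set zs" for x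
  proof -
    have x: "x \<in> V" using that zs(4) by blast
    have "M x = p x \<or> x = p (M x)" "K x = p x \<or> x = p (K x)"
      using bspec[OF f x] by (simp_all add: p_def MD(4) KD(4))
    then show ?thesis using zs(3) that unfolding traverses_def Field_cycle_edges by blast
  qed
  then show ?thesis using that[OF zs(1,2,4)] by blast
qed

section \<open>Graphs with exactly two cycles\<close>

text \<open>
  The combinatorial core of the theorem only needs the vertex set, the adjacency relation and
  lists that run through the two cycles. Cycles are compared by their edge sets, because a
  cycle is described by many lists.
\<close>
locale two_cycles =
  fixes V :: "'a set" and E :: "'a rel" and xs ys :: "'a list"
  assumes finite_V: "finite V" and E_sub: "E \<subseteq> V \<times> V" and sym_E: "sym E" and irrefl_E: "irrefl E"
    and cycle_xs: "is_cycle E xs" and cycle_ys: "is_cycle E ys"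
    and disjoint_edges: "cycle_edges xs \<inter> cycle_edges ys = {}"
    and only_cycles: "\<And>zs. is_cycle E zs \<Longrightarrow> cycle_edges zs \<in> {cycle_edges xs, cycle_edges ys}"
begin

lemma two_cycles_swap: "two_cycles V E ys xs"
  using two_cycles_axioms unfolding two_cycles_def by blast

lemma cycle_in_V:
  assumes "is_cycle E zs" shows "set zs \<subseteq> V"
proof -
  have "Field (cycle_edges zs) \<subseteq> V"
    using assms E_sub unfolding is_cycle_def Field_def by blast
  then show ?thesis by (simp add: Field_cycle_edges)
qed

lemma same_edges_same_vertices:
  assumes "cycle_edges zs = cycle_edges ws" shows "set zs = set ws"
  using assms by (metis Field_cycle_edges)

text \<open>
  Two edge-disjoint cycles through two common vertices would contain a third cycle: leave a
  common vertex \<open>u\<close> along the second cycle until it meets the first one again, and come back along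
  the first cycle. This third cycle has an edge of each of the two cycles, so it differs from both.
\<close>
lemma at_most_one_shared_vertex:
  assumes "u \<in> set xs" "u \<in> set ys" "w \<in> set xs" "w \<in> set ys"
  shows "u = w"
proof (rule ccontr)
  assume "u \<noteq> w"
  obtain xs' where xs': "is_cycle E (u # xs')" "set (u # xs') = set xs"
    "cycle_edges (u # xs') = cycle_edges xs" using is_cycle_rotate_to_front[OF cycle_xs assms(1)] by metis
  obtain ys' where ys': "is_cycle E (u # ys')" "set (u # ys') = set ys"
    "cycle_edges (u # ys') = cycle_edges ys" using is_cycle_rotate_to_front[OF cycle_ys assms(2)] by metis
  have "w \<in> set ys'" using \<open>u \<noteq> w\<close> ys'(2) assms(4) by auto
  then have "\<exists>t\<in>set ys'. t \<in> set xs" using assms(3) by blast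
  then obtain as t bs where ys_split: "ys' = as @ t # bs" and t: "t \<in> set xs"
    and as: "\<forall>a\<in>set as. a \<notin> set xs" using split_list_first_prop[of ys' "\<lambda>t. t \<in> set xs"] by blast
  have dx: "distinct (u # xs')" and dy: "distinct (u # ys')"
    using xs'(1) ys'(1) by (auto simp: is_cycle_def)
  have "t \<noteq> u" using dy ys_split by auto
  then have "t \<in> set xs'" using t xs'(2) by auto
  then obtain cs ds where xs_split: "xs' = cs @ t # ds" by (meson split_list)
  have sx: "successively (\<lambda>x y. (x, y) \<in> cycle_edges xs) (u # cs @ [t])"
  proof -
    have "successively (\<lambda>x y. (x, y) \<in> cycle_edges xs) ((u # cs @ [t]) @ ds @ [u])"
      using successively_cycle_edges[of u xs'] unfolding xs'(3) by (simp add: xs_split)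
    then show ?thesis unfolding successively_append_iff[of _ "u # cs @ [t]"] by blast
  qed
  have sy: "successively (\<lambda>x y. (x, y) \<in> cycle_edges ys) (u # as @ [t])"
  proof -
    have "successively (\<lambda>x y. (x, y) \<in> cycle_edges ys) ((u # as @ [t]) @ bs @ [u])"
      using successively_cycle_edges[of u ys'] unfolding ys'(3) by (simp add: ys_split)
    then show ?thesis unfolding successively_append_iff[of _ "u # as @ [t]"] by blast
  qed
  have symy: "(y, x) \<in> cycle_edges ys" if "(x, y) \<in> cycle_edges ys" for x y
    using sym_cycle_edges[of ys] that by (rule symD)
  \<comment> \<open>The new cycle runs from \<open>u\<close> to \<open>t\<close> along \<open>xs\<close> and back along the part \<open>as\<close> of \<open>ys\<close>.\<close>
  define zs where "zs = u # cs @ t # rev as"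
  have "successively (\<lambda>x y. (y, x) \<in> cycle_edges ys) (u # as @ [t])"
    by (rule successively_mono[OF sy]) (rule symy)
  then have "successively (\<lambda>x y. (x, y) \<in> cycle_edges ys) (rev (u # as @ [t]))"
    unfolding successively_rev .
  then have sy': "successively (\<lambda>x y. (x, y) \<in> cycle_edges ys) (t # rev as @ [u])" by simp
  define F where "F = cycle_edges xs \<union> cycle_edges ys"
  have F: "F \<subseteq> E" "sym F" using cycle_xs cycle_ys sym_cycle_edges[of xs] sym_cycle_edges[of ys]
    by (auto simp: F_def is_cycle_def intro: sym_Un)
  have "successively (\<lambda>x y. (x, y) \<in> F) (u # cs @ [t])"
    by (rule successively_mono[OF sx]) (simp add: F_def)
  moreover have "successively (\<lambda>x y. (x, y) \<in> F) (t # rev as @ [u])"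
    by (rule successively_mono[OF sy']) (simp add: F_def)
  ultimately have suc: "successively (\<lambda>x y. (x, y) \<in> F) (u # (cs @ t # rev as) @ [u])"
    using successively_append_iff[of "\<lambda>x y. (x, y) \<in> F" "u # cs" "t # rev as @ [u]"]
      successively_append_iff[of "\<lambda>x y. (x, y) \<in> F" "u # cs" "[t]"] by simp
  have zF: "cycle_edges zs \<subseteq> F"
    unfolding zs_def by (rule cycle_edges_subset_if_successively[OF suc F(2)])
  have first: "(u, hd (cs @ [t])) \<in> cycle_edges xs" "(u, hd (as @ [t])) \<in> cycle_edges ys"
    using sx sy by (auto simp: successively_Cons)
  have len: "cs \<noteq> [] \<or> as \<noteq> []" using first disjoint_edges by auto
  have "distinct zs"
    using dx dy as xs'(2) unfolding zs_def xs_split ys_split by auto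
  moreover have "3 \<le> length zs" using len by (cases cs; cases as) (auto simp: zs_def)
  ultimately have "is_cycle E zs" using zF F(1) by (simp add: is_cycle_def)
  then have zs: "cycle_edges zs = cycle_edges xs \<or> cycle_edges zs = cycle_edges ys"
    using only_cycles by blast
  have sz: "successively (\<lambda>x y. (x, y) \<in> cycle_edges zs) (u # cs @ t # rev as @ [u])"
    using successively_cycle_edges[of u "cs @ t # rev as"] by (simp add: zs_def)
  then have "(u, hd (cs @ [t])) \<in> cycle_edges zs"
    by (cases cs) (auto simp: successively_Cons)
  moreover have "(hd (as @ [t]), u) \<in> cycle_edges zs"
  proof (cases as)
    case Nil
    then show ?thesis using sz by (auto simp: successively_append_iff successively_Cons)
  next
    case (Cons a as')
    have "successively (\<lambda>x y. (x, y) \<in> cycle_edges zs) ((u # cs @ t # rev as') @ [a] @ [u])"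
      using sz by (simp add: Cons)
    then show ?thesis unfolding Cons successively_append_iff[of _ _ "[a] @ [u]"] by simp
  qed
  then have "(u, hd (as @ [t])) \<in> cycle_edges zs"
    by (rule symD[OF sym_cycle_edges])
  ultimately show False using zs first disjoint_edges by auto
qed

lemma adj_perm_moves:
  assumes "p \<in> adj_perms E W" "v \<in> W" shows "p v \<noteq> v"
  using adj_permsD(2)[OF assms] irrefl_E by (auto dest: irreflD)

lemma traverses_xs_or_ys:
  assumes "p \<in> adj_perms E V" "p (p v) \<noteq> v"
  shows "(traverses p (cycle_edges xs) \<and> v \<in> set xs) \<or> (traverses p (cycle_edges ys) \<and> v \<in> set ys)"
proof -
  have "v \<in> V" using permutes_not_in[OF adj_permsD(1)[OF assms(1)], of v] assms(2) by fastforce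
  then have "p v \<noteq> v" using adj_perm_moves[OF assms(1)] by simp
  then obtain zs where "is_cycle E zs" "v \<in> set zs" "traverses p (cycle_edges zs)"
    using orbit_is_cycle[OF assms(1) finite_V sym_E _ assms(2)] by metis
  then show ?thesis using only_cycles[of zs] same_edges_same_vertices[of zs xs] same_edges_same_vertices[of zs ys] by auto
qed

lemma alternating_xs_or_ys:
  assumes "M \<in> matchings E W" "K \<in> matchings E W" "W \<subseteq> V" "M v \<noteq> K v"
  obtains zs where "zs = xs \<or> zs = ys" "v \<in> set zs" "set zs \<subseteq> W"
    "\<And>x. x \<in> set zs \<Longrightarrow> (x, M x) \<in> cycle_edges zs \<and> (x, K x) \<in> cycle_edges zs"
proof -
  have "finite W" using assms(3) finite_V by (rule finite_subset)
  obtain ws where ws: "is_cycle E ws" "v \<in> set ws" "set ws \<subseteq> W"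
    "\<And>x. x \<in> set ws \<Longrightarrow> (x, M x) \<in> cycle_edges ws \<and> (x, K x) \<in> cycle_edges ws"
    using alternating_cycle[OF assms(1,2) \<open>finite W\<close> sym_E irrefl_E assms(4)] by metis
  from only_cycles[OF ws(1)] obtain zs where zs: "zs = xs \<or> zs = ys" "cycle_edges ws = cycle_edges zs"
    by blast
  then show ?thesis using that[of zs] ws same_edges_same_vertices[OF zs(2)] by simp
qed

text \<open>
  Toggling along the cycle gives a second matching.
\<close>
lemma not_unique_if_matching_along_cycle:
  assumes zs: "zs = xs \<or> zs = ys"
    and M: "M \<in> matchings E V" "\<And>x. x \<in> set zs \<Longrightarrow> (x, M x) \<in> cycle_edges zs"
  shows "card (matchings E V) \<noteq> 1"
proof
  assume one: "card (matchings E V) = 1"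
  have cyc: "is_cycle E zs" using zs cycle_xs cycle_ys by auto
  then have "distinct zs" "zs \<noteq> []" by (auto simp: is_cycle_def)
  then obtain c where c: "c permutes set zs" "map c zs = rotate1 zs" using ex_rotation by blast
  note T = toggle_matching[OF cyc c M cycle_in_V[OF cyc]]
  have "toggle c (set zs) M = M"
    using one T(1) M(1) by (metis card_1_singletonE singletonD)
  moreover have "hd zs \<in> set zs" using \<open>zs \<noteq> []\<close> by simp
  ultimately show False using T(4) by metis
qed

text \<open>
  If there are two matchings, they differ along one of the two cycles. Every other matching must also
  stay on this cycle: where it deviates from the first, it does so along a cycle that contains
  an edge of the given one, hence along the same cycle. So toggling pairs off all matchings.
\<close>
lemma odd_matchings_unique:
  assumes "odd (card (matchings E V))"
  shows "card (matchings E V) = 1"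
proof (rule ccontr)
  assume ne1: "card (matchings E V) \<noteq> 1"
  obtain M where M: "M \<in> matchings E V" using assms by fastforce
  have "matchings E V \<noteq> {M}" using ne1 by auto
  then obtain N where N: "N \<in> matchings E V" "M \<noteq> N" using M by blast
  then obtain v where "M v \<noteq> N v" by blast
  then obtain zs where zs: "zs = xs \<or> zs = ys"
    and along: "\<And>x. x \<in> set zs \<Longrightarrow> (x, M x) \<in> cycle_edges zs"
    using alternating_xs_or_ys[OF M N(1) subset_refl] by metis
  have cyc: "is_cycle E zs" using zs cycle_xs cycle_ys by auto
  then have "distinct zs" "zs \<noteq> []" by (auto simp: is_cycle_def)
  then obtain c where c: "c permutes set zs" "map c zs = rotate1 zs" using ex_rotation by blast
  have all: "(x, K x) \<in> cycle_edges zs" if K: "K \<in> matchings E V" and x: "x \<in> set zs" for K x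
  proof (cases "K x = M x")
    case True
    then show ?thesis using along[OF x] by simp
  next
    case False
    then obtain ws where ws: "ws = xs \<or> ws = ys" "x \<in> set ws"
      "\<And>x. x \<in> set ws \<Longrightarrow> (x, K x) \<in> cycle_edges ws \<and> (x, M x) \<in> cycle_edges ws"
      using alternating_xs_or_ys[OF K M subset_refl] by metis
    have *: "(x, K x) \<in> cycle_edges ws" "(x, M x) \<in> cycle_edges ws" using ws(2,3) by auto
    \<comment> \<open>The \<open>M\<close>-edge at \<open>x\<close> lies on both cycles, which are edge-disjoint unless they are equal.\<close>
    then have "ws = zs" using zs ws(1) along[OF x] disjoint_edges by auto
    then show ?thesis using * by simp
  qed
  have "even (card (matchings E V))"
  proof (rule even_card_if_involution[where f = "toggle c (set zs)"])
    fix K assume K: "K \<in> matchings E V"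
    note T = toggle_matching[OF cyc c K all[OF K] cycle_in_V[OF cyc]]
    have "hd zs \<in> set zs" using \<open>zs \<noteq> []\<close> by simp
    then have "toggle c (set zs) K \<noteq> K" using T(4) by metis
    then show "toggle c (set zs) K \<in> matchings E V \<and> toggle c (set zs) K \<noteq> K \<and>
        toggle c (set zs) (toggle c (set zs) K) = K" using T(1,3) by simp
  qed (rule finite_matchings[OF finite_V])
  then show False using assms by simp
qed

text \<open>
  A matching of the rest could be completed by a matching of the even cycle, and the result would run along
  that cycle.
\<close>
lemma even_cycle_no_rest:
  assumes "card (matchings E V) = 1" "zs = xs \<or> zs = ys" "even (length zs)"
  shows "matchings E (V - set zs) = {}"
proof (rule ccontr)
  assume "matchings E (V - set zs) \<noteq> {}"
  then obtain N where N: "N \<in> matchings E (V - set zs)" by blast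
  have cyc: "is_cycle E zs" using assms(2) cycle_xs cycle_ys by auto
  then have "distinct zs" "cycle_edges zs \<subseteq> E" by (auto simp: is_cycle_def)
  then obtain K where K: "K \<in> matchings (cycle_edges zs) (set zs)"
    using matching_of_even_cycle[OF _ assms(3)] by blast
  then have KE: "K \<in> matchings E (set zs)" using matchings_mono[OF \<open>cycle_edges zs \<subseteq> E\<close>] by blast
  have "set zs \<union> (V - set zs) = V" using cycle_in_V[OF cyc] by blast
  then have "K \<circ> N \<in> matchings E V" using compose_matchings[OF KE N] by simp
  moreover have "(x, (K \<circ> N) x) \<in> cycle_edges zs" if "x \<in> set zs" for x
    using compose_disjoint(1)[OF matchingsD(2)[OF KE] matchingsD(2)[OF N]] that matchingsD(3)[OF K that]
    by simp
  ultimately show False using not_unique_if_matching_along_cycle[OF assms(2)] assms(1) by blast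
qed

lemma even_card_if_unique_matching:
  assumes "card (matchings E V) = 1" shows "even (card V)"
proof -
  obtain M where "M \<in> matchings E V" using assms by fastforce
  then show ?thesis using finite_V irrefl_E by (rule even_card_if_matching)
qed

text \<open>
  If \<open>p\<close> were an involution off the cycle, it would match the remaining vertices perfectly, and their
  number would be even. Then the cycle would be even too, since the whole graph has an even
  number of vertices.
\<close>
lemma not_involution_off_cycle:
  assumes one: "card (matchings E V) = 1" and p: "p \<in> adj_perms E V"
    and zs: "zs = xs \<or> zs = ys" "traverses p (cycle_edges zs)"
  shows "\<exists>v. v \<notin> set zs \<and> p (p v) \<noteq> v"
proof (rule ccontr)
  assume "\<not> ?thesis"
  then have inv: "p (p v) = v" if "v \<notin> set zs" for v using that by blast
  have cyc: "is_cycle E zs" using zs cycle_xs cycle_ys by auto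
  note sub = cycle_in_V[OF cyc]
  have rest: "restrict_id p (V - set zs) \<in> matchings E (V - set zs)"
    using traverses_edge(2)[OF zs(2)] inv
    by (intro restrict_matching[OF p finite_V sub]) (auto simp: Field_cycle_edges)
  then have "even (card (V - set zs))"
    using even_card_if_matching finite_V irrefl_E by blast
  moreover have "card (V - set zs) = card V - length zs" "length zs \<le> card V"
    using sub cyc finite_V card_mono[OF finite_V sub]
    by (auto simp: card_Diff_subset distinct_card is_cycle_def)
  ultimately have "even (length zs)" using even_card_if_unique_matching[OF one] by presburger
  then show False using even_cycle_no_rest[OF one zs(1)] rest by blast
qed

text \<open>
  With a unique perfect matching, every other term of the determinant comes from a permutation
  that turns both cycles and matches the rest. Two traversed cycles are disjoint since the
  permutation has only one value at a common vertex.
\<close>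
lemma non_involution_structure:
  assumes one: "card (matchings E V) = 1" and p: "p \<in> adj_perms E V" "p \<notin> matchings E V"
  shows "traverses p (cycle_edges xs)" "traverses p (cycle_edges ys)" "set xs \<inter> set ys = {}"
    "restrict_id p (V - (set xs \<union> set ys)) \<in> matchings E (V - (set xs \<union> set ys))"
proof -
  obtain v where v: "p (p v) \<noteq> v" using p by (auto simp: matchings_def)
  have both: "traverses p (cycle_edges xs) \<and> traverses p (cycle_edges ys)"
    using traverses_xs_or_ys[OF p(1) v]
  proof (elim disjE conjE)
    assume t: "traverses p (cycle_edges xs)"
    obtain w where "w \<notin> set xs" "p (p w) \<noteq> w"
      using not_involution_off_cycle[OF one p(1) disjI1[OF refl] t] by blast
    then show ?thesis using t traverses_xs_or_ys[OF p(1)] by blast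
  next
    assume t: "traverses p (cycle_edges ys)"
    obtain w where "w \<notin> set ys" "p (p w) \<noteq> w"
      using not_involution_off_cycle[OF one p(1) disjI2[OF refl] t] by blast
    then show ?thesis using t traverses_xs_or_ys[OF p(1)] by blast
  qed
  then show tx: "traverses p (cycle_edges xs)" and ty: "traverses p (cycle_edges ys)" by auto
  show "set xs \<inter> set ys = {}"
  proof (rule ccontr)
    assume "set xs \<inter> set ys \<noteq> {}"
    then obtain x where "x \<in> set xs" "x \<in> set ys" by blast
    then have "(x, p x) \<in> cycle_edges xs \<inter> cycle_edges ys"
      using traverses_edge(1)[OF tx] traverses_edge(1)[OF ty] by (simp add: Field_cycle_edges)
    then show False using disjoint_edges by simp
  qed
  show "restrict_id p (V - (set xs \<union> set ys)) \<in> matchings E (V - (set xs \<union> set ys))"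
  proof (rule restrict_matching[OF p(1) finite_V])
    show "set xs \<union> set ys \<subseteq> V" using cycle_in_V cycle_xs cycle_ys by simp
    show "p x \<in> set xs \<union> set ys" if "x \<in> set xs \<union> set ys" for x
      using that traverses_edge(2)[OF tx] traverses_edge(2)[OF ty] by (auto simp: Field_cycle_edges)
    show "p (p v) = v" if "v \<in> V - (set xs \<union> set ys)" for v
      using that traverses_xs_or_ys[OF p(1), of v] by blast
  qed
qed

text \<open>
  Two such permutations agree except that they may turn the cycles in different directions.
  Reversing a direction is composition with a square, so it keeps the sign.
\<close>
lemma non_involutions_same_sign:
  assumes one: "card (matchings E V) = 1"
    and p: "p \<in> adj_perms E V" "p \<notin> matchings E V"
    and r: "r \<in> adj_perms E V" "r \<notin> matchings E V"
  shows "sign r = sign p"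
proof -
  note P = non_involution_structure[OF one p] and R = non_involution_structure[OF one r]
  note perm_p = adj_permsD(1)[OF p(1)] and perm_r = adj_permsD(1)[OF r(1)]
  define W where "W = V - (set xs \<union> set ys)"
  let ?i = "inv_into UNIV p"
  have ip: "p (?i v) = v" "?i (p v) = v" for v using perm_p by (simp_all add: permutes_inverses)
  \<comment> \<open>Off the cycles there is only one perfect matching, since any difference would close up to one
      of the two cycles.\<close>
  have on_W: "r v = p v" if "v \<in> W" for v
  proof (rule ccontr)
    assume "r v \<noteq> p v"
    then have "restrict_id p W v \<noteq> restrict_id r W v" using that by simp
    then obtain zs where "zs = xs \<or> zs = ys" "v \<in> set zs"
      using alternating_xs_or_ys[of "restrict_id p W" W "restrict_id r W" v] P(4) R(4)
      unfolding W_def[symmetric] by (metis Diff_subset W_def)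
    then show False using that by (auto simp: W_def)
  qed
  have on_cycle: "(r v = p v \<or> r v = ?i v) \<and> r (r v) \<noteq> v" if v: "v \<in> set xs \<union> set ys" for v
  proof -
    obtain zs where zs: "v \<in> set zs" "is_cycle E zs" "traverses p (cycle_edges zs)"
      "traverses r (cycle_edges zs)"
      using v P(1,2) R(1,2) cycle_xs cycle_ys by blast
    have "(v, r v) \<in> cycle_edges zs"
      using zs(1) traverses_edge(1)[OF zs(4)] by (simp add: Field_cycle_edges)
    then have "r v = p v \<or> v = p (r v)" using zs(3) unfolding traverses_def by blast
    then have "r v = p v \<or> r v = ?i v" using ip(2) by metis
    moreover have "r (r v) \<noteq> v"
      using traverses_involution_free[OF zs(4) permutes_inj[OF perm_r]] zs(1,2)
      by (simp add: is_cycle_def)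
    ultimately show ?thesis by simp
  qed
  have off: "p v = v \<and> r v = v" if "v \<notin> V" for v
    using that perm_p perm_r by (simp add: permutes_not_in)
  \<comment> \<open>\<open>A\<close> is where \<open>r\<close> runs against \<open>p\<close>; there \<open>r\<close> arises from \<open>p\<close> by composing twice with its
      inverse, and two equal factors do not change the sign.\<close>
  define A where "A = {v. r v \<noteq> p v}"
  define g where "g v = (if v \<in> A then ?i v else v)" for v
  have A_cycle: "v \<in> set xs \<union> set ys" if "v \<in> A" for v
  proof (rule ccontr)
    assume "v \<notin> set xs \<union> set ys"
    moreover have "r v \<noteq> p v" using that by (simp add: A_def)
    then have "v \<in> V" using off by metis
    ultimately have "v \<in> W" by (simp add: W_def)
    then show False using on_W that by (simp add: A_def)
  qed
  then have A: "r v = ?i v \<and> r (r v) \<noteq> v" if "v \<in> A" for v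
    using on_cycle[of v] that by (auto simp: A_def)
  have "A \<subseteq> V" using A_cycle cycle_in_V cycle_xs cycle_ys by blast
  then have "finite A" using finite_V finite_subset by blast
  have A_closed: "?i v \<in> A" if "v \<in> A" for v
    using A[OF that] ip(1) by (metis (mono_tags) A_def mem_Collect_eq)
  have "inj_on ?i A" using ip(1) by (metis inj_onI)
  then have "?i ` A = A" using \<open>finite A\<close> A_closed by (simp add: endo_inj_surj image_subsetI)
  then have "bij_betw g A A"
    using \<open>inj_on ?i A\<close> by (auto simp: bij_betw_def g_def inj_on_def)
  then have g: "g permutes A" by (rule bij_imp_permutes) (simp add: g_def)
  have "r = p \<circ> (g \<circ> g)"
  proof
    fix v show "r v = (p \<circ> (g \<circ> g)) v"
    proof (cases "v \<in> A")
      case True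
      then show ?thesis using A[OF True] A_closed[OF True] by (simp add: g_def ip)
    next
      case False
      then show ?thesis by (simp add: g_def A_def)
    qed
  qed
  moreover have "permutation g" using g \<open>finite A\<close> permutation_permutes by blast
  moreover have "permutation p" using perm_p finite_V permutation_permutes by blast
  ultimately show ?thesis by (simp add: sign_compose permutation_compose sign_idempotent)
qed

text \<open>
  A matching of the rest would extend over the odd cycle without its common vertex, that is, to all
  vertices off the even cycle.
\<close>
lemma shared_vertex_no_rest:
  assumes one: "card (matchings E V) = 1" and u: "u \<in> set xs" "u \<in> set ys"
    and "even (length xs)" "odd (length ys)"
  shows "matchings E (V - (set xs \<union> set ys)) = {}"
proof (rule ccontr)
  assume "matchings E (V - (set xs \<union> set ys)) \<noteq> {}"
  then obtain N where N: "N \<in> matchings E (V - (set xs \<union> set ys))" by blast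
  have "distinct ys" "cycle_edges ys \<subseteq> E" using cycle_ys by (auto simp: is_cycle_def)
  then obtain K where "K \<in> matchings E (set ys - {u})"
    using matching_of_odd_cycle_minus_vertex[OF _ assms(5) u(2)] matchings_mono by blast
  then have "K \<circ> N \<in> matchings E ((set ys - {u}) \<union> (V - (set xs \<union> set ys)))"
    using N by (rule compose_matchings) blast
  moreover have "(set ys - {u}) \<union> (V - (set xs \<union> set ys)) = V - set xs"
    using at_most_one_shared_vertex[OF u] u cycle_in_V[OF cycle_ys] by blast
  ultimately show False using even_cycle_no_rest[OF one disjI1[OF refl] assms(4)] by auto
qed

text \<open>
  With exactly one common vertex, and an even number of vertices left over in an even total, the
  two cycle lengths have different parity.
\<close>
lemma rest_matching_disjoint:
  assumes one: "card (matchings E V) = 1" and N: "matchings E (V - (set xs \<union> set ys)) \<noteq> {}"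
  shows "set xs \<inter> set ys = {}"
proof (rule ccontr)
  assume "set xs \<inter> set ys \<noteq> {}"
  then obtain u where u: "u \<in> set xs" "u \<in> set ys" by blast
  have "set xs \<inter> set ys = {u}" using at_most_one_shared_vertex[OF u] u by blast
  then have card_Int: "card (set xs \<inter> set ys) = 1" by simp
  have sub: "set xs \<union> set ys \<subseteq> V" using cycle_in_V cycle_xs cycle_ys by simp
  have "even (card (V - (set xs \<union> set ys)))"
    using N even_card_if_matching finite_V irrefl_E by blast
  moreover have "card (V - (set xs \<union> set ys)) + card (set xs \<union> set ys) = card V"
    using sub finite_V by (simp add: card_Diff_subset card_mono)
  moreover have "card (set xs \<union> set ys) + 1 = length xs + length ys"
    using card_Un_Int[of "set xs" "set ys"] card_Int cycle_xs cycle_ys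
    by (simp add: distinct_card is_cycle_def)
  ultimately have "odd (length xs + length ys)" using even_card_if_unique_matching[OF one] by presburger
  then consider "even (length xs)" "odd (length ys)" | "odd (length xs)" "even (length ys)" by auto
  then show False
  proof cases
    case 1
    then show ?thesis using shared_vertex_no_rest[OF one u] N by blast
  next
    case 2
    then show ?thesis
      using two_cycles.shared_vertex_no_rest[OF two_cycles_swap one u(2,1)] N by (simp add: Un_commute)
  qed
qed

text \<open>
  The directions of the two cycles can be chosen independently; three of the four choices are
  enough, because terms of equal sign then outweigh the one that stems from the matching.
\<close>
lemma three_non_involutions:
  assumes disj: "set xs \<inter> set ys = {}" and N: "N \<in> matchings E (V - (set xs \<union> set ys))"
  shows "3 \<le> card (adj_perms E V - matchings E V)"
proof -
  let ?W = "V - (set xs \<union> set ys)"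
  have dist: "distinct xs" "3 \<le> length xs" "distinct ys" "3 \<le> length ys"
    and sub: "cycle_edges xs \<subseteq> E" "cycle_edges ys \<subseteq> E"
    using cycle_xs cycle_ys by (auto simp: is_cycle_def)
  obtain c where c: "c permutes set xs" "map c xs = rotate1 xs" using ex_rotation dist(1) by blast
  obtain d where d: "d permutes set ys" "map d ys = rotate1 ys" using ex_rotation dist(3) by blast
  have rot: "c \<in> adj_perms E (set xs)" "d \<in> adj_perms E (set ys)"
    using cycle_edges_conv_rotation[OF c(2) permutes_inj[OF c(1)]]
      cycle_edges_conv_rotation[OF d(2) permutes_inj[OF d(1)]] c(1) d(1) sub
    by (auto simp: adj_perms_def)
  have V: "set xs \<union> (set ys \<union> ?W) = V" using cycle_in_V cycle_xs cycle_ys by blast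
  have glue: "f \<circ> (h \<circ> N) \<in> adj_perms E V \<and> (\<forall>x\<in>set xs. (f \<circ> (h \<circ> N)) x = f x) \<and>
      (\<forall>y\<in>set ys. (f \<circ> (h \<circ> N)) y = h y)"
    if f: "f \<in> adj_perms E (set xs)" and h: "h \<in> adj_perms E (set ys)" for f h
  proof -
    note perms = adj_permsD(1)[OF f] adj_permsD(1)[OF h] matchingsD(2)[OF N]
    have hN: "h \<circ> N \<in> adj_perms E (set ys \<union> ?W)"
      using h matchingsD(1)[OF N] by (rule compose_adj_perms) blast
    have dj: "set xs \<inter> (set ys \<union> ?W) = {}" using disj by blast
    note hNp = adj_permsD(1)[OF hN]
    have "f \<circ> (h \<circ> N) \<in> adj_perms E V"
      using compose_adj_perms[OF f hN dj] V by simp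
    moreover have "(f \<circ> (h \<circ> N)) x = f x" if "x \<in> set xs" for x
      using compose_disjoint(1)[OF perms(1) hNp dj that] .
    moreover have "(f \<circ> (h \<circ> N)) y = h y" if y: "y \<in> set ys" for y
    proof -
      have "y \<notin> set xs" using y disj by blast
      then have "(f \<circ> (h \<circ> N)) y = (h \<circ> N) y" by (rule compose_disjoint(2)[OF perms(1) hNp dj])
      also have "\<dots> = h y" by (rule compose_disjoint(1)[OF perms(2,3) _ y]) blast
      finally show ?thesis .
    qed
    ultimately show ?thesis by blast
  qed
  let ?ci = "inv_into UNIV c" and ?di = "inv_into UNIV d"
  have inv: "?ci \<in> adj_perms E (set xs)" "?di \<in> adj_perms E (set ys)"
    using inv_adj_perms rot sym_E by blast+
  obtain x y where x: "x \<in> set xs" and y: "y \<in> set ys" using dist by (cases xs; cases ys) auto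
  have cc: "c (c x) \<noteq> x" "d (d y) \<noteq> y"
    using traverses_involution_free[OF traverses_if_rotation[OF c(2)] _ dist(1,2) x]
      traverses_involution_free[OF traverses_if_rotation[OF d(2)] _ dist(3,4) y]
      permutes_inj[OF c(1)] permutes_inj[OF d(1)] by auto
  then have ne: "?ci x \<noteq> c x" "?di y \<noteq> d y"
    using permutes_inverses(1)[OF c(1), of x] permutes_inverses(1)[OF d(1), of y] by auto
  have ne2: "?di (?di y) \<noteq> y"
    using cc(2) permutes_inverses(1)[OF d(1)] by metis
  have X: "c x \<in> set xs" "?ci x \<in> set xs" "d y \<in> set ys" "?di y \<in> set ys"
    using x y c(1) d(1) permutes_inv[OF c(1)] permutes_inv[OF d(1)] by (simp_all add: permutes_in_image)
  define p0 p1 p2 where "p0 = c \<circ> (d \<circ> N)" and "p1 = ?ci \<circ> (d \<circ> N)" and "p2 = c \<circ> (?di \<circ> N)"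
  note G = glue[OF rot, folded p0_def] glue[OF inv(1) rot(2), folded p1_def]
    glue[OF rot(1) inv(2), folded p2_def]
  have "p0 (p0 y) \<noteq> y" "p1 (p1 y) \<noteq> y" "p2 (p2 y) \<noteq> y"
    using G y X cc(2) ne2 by simp_all
  then have "{p0, p1, p2} \<subseteq> adj_perms E V - matchings E V"
    using G by (auto simp: matchings_def)
  moreover have "card {p0, p1, p2} = 3"
  proof -
    have "p0 x \<noteq> p1 x" "p0 y \<noteq> p2 y" "p1 x \<noteq> p2 x" using G x y ne by simp_all
    then have "p0 \<noteq> p1" "p0 \<noteq> p2" "p1 \<noteq> p2" by auto
    then show ?thesis by simp
  qed
  ultimately show ?thesis using finite_adj_perms[OF finite_V, of E] by (metis card_mono finite_Diff)
qed

text \<open>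
  Inversion pairs off the permutations that are not involutions, so the sum has the parity of the number
  of matchings. In the case of a unique matching, the remaining terms have the same sign. If the
  rest has no matching there are none of them; otherwise there are at least three and they
  cannot be cancelled down to \<open>\<plusminus>1\<close>.
\<close>
theorem sum_sign_unit_iff:
  "(\<Sum>p\<in>adj_perms E V. sign p) \<in> {-1, 1} \<longleftrightarrow>
    card (matchings E V) = 1 \<and> matchings E (V - (set xs \<union> set ys)) = {}"
proof -
  let ?S = "adj_perms E V" and ?M = "matchings E V"
  let ?N = "?S - ?M"
  have fin: "finite ?S" "finite ?M" "?M \<subseteq> ?S"
    using finite_adj_perms finite_matchings finite_V by (auto simp: matchings_def)
  have split: "(\<Sum>p\<in>?S. sign p) = (\<Sum>p\<in>?M. sign p) + (\<Sum>p\<in>?N. sign p)"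
    using sum.subset_diff[OF fin(3,1), of sign] by simp
  have "even (card ?N)"
  proof (rule even_card_if_involution[where f = "inv_into UNIV"])
    show "finite ?N" using fin by simp
    fix p assume "p \<in> ?N"
    then have p: "p \<in> ?S" "p \<notin> ?M" by auto
    note perm = adj_permsD(1)[OF p(1)]
    have ii: "inv_into UNIV (inv_into UNIV p) = p" using perm by (rule permutes_inv_inv)
    have ne: "inv_into UNIV p \<noteq> p"
    proof
      assume "inv_into UNIV p = p"
      then have "p (p v) = v" for v using permutes_inverses(1)[OF perm, of v] by simp
      then show False using p by (simp add: matchings_def)
    qed
    have "inv_into UNIV p \<notin> ?M"
    proof
      assume I: "inv_into UNIV p \<in> ?M"
      have "p v = inv_into UNIV p v" for v
        using matchingsD(4)[OF I] permutes_inverses(2)[OF perm] by metis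
      then show False using ne by auto
    qed
    then show "inv_into UNIV p \<in> ?N \<and> inv_into UNIV p \<noteq> p \<and> inv_into UNIV (inv_into UNIV p) = p"
      using inv_adj_perms[OF p(1) sym_E] ne ii by blast
  qed
  moreover have parity: "even (\<Sum>p\<in>A. sign p) \<longleftrightarrow> even (card A)" if "finite A"
    for A :: "('a \<Rightarrow> 'a) set"
    using that by (induction A rule: finite_induct) (auto simp: sign_def)
  ultimately have mod2: "odd (\<Sum>p\<in>?S. sign p) \<longleftrightarrow> odd (card ?M)"
    using parity[of ?M] parity[of ?N] fin by (simp add: split)
  show ?thesis
  proof (cases "card ?M = 1")
    case False
    then have "even (card ?M)" using odd_matchings_unique by blast
    then have "even (\<Sum>p\<in>?S. sign p)" using mod2 by blast
    then have "(\<Sum>p\<in>?S. sign p) \<notin> {-1, 1}" by auto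
    then show ?thesis using False by blast
  next
    case one: True
    then obtain M where M: "?M = {M}" by (metis card_1_singletonE)
    show ?thesis
    proof (cases "matchings E (V - (set xs \<union> set ys)) = {}")
      case True
      then have N: "?N = {}" using non_involution_structure(4)[OF one] by blast
      have "(\<Sum>p\<in>?N. sign p) = 0" unfolding N by simp
      then have "(\<Sum>p\<in>?S. sign p) = sign M" using split M by simp
      then show ?thesis using True one by (simp add: sign_def)
    next
      case False
      then obtain K where K: "K \<in> matchings E (V - (set xs \<union> set ys))" by blast
      have three: "3 \<le> card ?N"
        using three_non_involutions[OF rest_matching_disjoint[OF one False] K] .
      then have "card ?N \<noteq> 0" by linarith
      then obtain p where p: "p \<in> ?N" by (metis card.empty ex_in_conv)
      have "(\<Sum>r\<in>?N. sign r) = (\<Sum>r\<in>?N. sign p)"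
        using non_involutions_same_sign[OF one] p by (intro sum.cong refl) blast
      then have "(\<Sum>r\<in>?S. sign r) = sign M + int (card ?N) * sign p" using split M by simp
      then have "(\<Sum>r\<in>?S. sign r) \<notin> {-1, 1}" using three by (auto simp: sign_def split: if_splits)
      then show ?thesis using False by blast
    qed
  qed
qed

end

section \<open>A connected graph with n + 1 edges has at most two edge-disjoint cycles\<close>

text \<open>
  Choose a parent for each vertex other than the root, one step closer to the root. The pairs with the
  parent first and those with the parent second are all distinct, since the distance to the root
  orients them.
\<close>
lemma card_edges_connected:
  assumes "finite V" "finite F" "sym F" "r \<in> V" and reach: "\<And>v. v \<in> V \<Longrightarrow> (r, v) \<in> F\<^sup>*"
  shows "2 * (card V - 1) \<le> card F"
proof -
  define d where "d v = (LEAST n. (r, v) \<in> F ^^ n)" for v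
  have "\<exists>u. (u, v) \<in> F \<and> d u < d v" if v: "v \<in> V" "v \<noteq> r" for v
  proof -
    have "\<exists>n. (r, v) \<in> F ^^ n" using reach[OF v(1)] by (rule rtrancl_imp_relpow)
    then have dv: "(r, v) \<in> F ^^ d v" unfolding d_def by (rule LeastI_ex)
    then have "d v \<noteq> 0" using v(2) by (metis relpow_0_E)
    then obtain m where m: "d v = Suc m" by (metis not0_implies_Suc)
    then obtain u where u: "(r, u) \<in> F ^^ m" "(u, v) \<in> F" using dv by (metis relpow_Suc_E)
    have "d u \<le> m" unfolding d_def using u(1) by (rule Least_le)
    then show ?thesis using u(2) m by auto
  qed
  then have "\<forall>v\<in>V - {r}. \<exists>u. (u, v) \<in> F \<and> d u < d v" by simp
  from bchoice[OF this]
  obtain par where par: "\<forall>v\<in>V - {r}. (par v, v) \<in> F \<and> d (par v) < d v" ..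
  let ?A = "(\<lambda>v. (par v, v)) ` (V - {r})" and ?B = "(\<lambda>v. (v, par v)) ` (V - {r})"
  have "card ?A = card (V - {r})" "card ?B = card (V - {r})"
    by (intro card_image inj_onI; simp)+
  moreover have "?A \<inter> ?B = {}"
  proof (rule ccontr)
    assume "?A \<inter> ?B \<noteq> {}"
    then obtain x where x: "x \<in> ?A" "x \<in> ?B" by blast
    obtain v where v: "v \<in> V - {r}" "x = (par v, v)" using x(1) by blast
    obtain w where w: "w \<in> V - {r}" "x = (w, par w)" using x(2) by blast
    have "d w < d v" using bspec[OF par v(1)] v(2) unfolding w(2) by (metis Pair_inject)
    moreover have "d v < d w" using bspec[OF par w(1)] w(2) unfolding v(2) by (metis Pair_inject)
    ultimately show False by simp
  qed
  moreover have "card (V - {r}) = card V - 1" using assms(4) by (rule card_Diff_singleton)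
  ultimately have "card (?A \<union> ?B) = 2 * (card V - 1)"
    using assms(1) by (simp add: card_Un_disjoint)
  moreover have "?A \<union> ?B \<subseteq> F" using par \<open>sym F\<close> by (auto dest: symD)
  ultimately show ?thesis using card_mono[OF assms(2)] by metis
qed

lemma successively_rtrancl:
  assumes "successively (\<lambda>x y. (x, y) \<in> F) (a # xs)"
  shows "(a, last (a # xs)) \<in> F\<^sup>*"
  using assms
proof (induction xs arbitrary: a)
  case (Cons b xs)
  then have "(a, b) \<in> F" "(b, last (b # xs)) \<in> F\<^sup>*" by auto
  then show ?case by (simp add: converse_rtrancl_into_rtrancl)
qed simp

text \<open>
  An edge of a cycle can be bypassed along the rest of the cycle. The relation is symmetric, so
  an edge is a set of two pairs.
\<close>
lemma remove_cycle_edge: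
  assumes "finite E" "sym E" "is_cycle E zs"
  obtains F where "F \<subseteq> E" "sym F" "E \<subseteq> F\<^sup>*" "card F + 2 = card E" "E - F \<subseteq> cycle_edges zs"
proof -
  have "3 \<le> length zs" using assms(3) by (simp add: is_cycle_def)
  then obtain a b w ws' where "zs = a # b # w # ws'"
    by (auto simp: numeral_3_eq_3 Suc_le_length_iff)
  then obtain ws where zs: "zs = a # b # ws" "ws \<noteq> []" by blast
  have dist: "distinct (a # b # ws)" and sub: "cycle_edges zs \<subseteq> E"
    using assms(3) by (auto simp: is_cycle_def zs)
  have suc: "successively (\<lambda>x y. (x, y) \<in> cycle_edges zs) ([a, b] @ ws @ [a])"
    using successively_cycle_edges[of a "b # ws"] by (simp add: zs)
  then have ab: "(a, b) \<in> cycle_edges zs" and bw: "(b, hd ws) \<in> cycle_edges zs"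
    and wa: "successively (\<lambda>x y. (x, y) \<in> cycle_edges zs) (ws @ [a])"
    using zs(2) by (auto simp: successively_append_iff successively_Cons)
  have ba: "(b, a) \<in> cycle_edges zs" using symD[OF sym_cycle_edges ab] .
  define F where "F = E - {(a, b), (b, a)}"
  have "successively (\<lambda>x y. (x, y) \<in> F) (ws @ [a])"
    by (rule successively_mono[OF wa]) (use sub dist in \<open>auto simp: F_def\<close>)
  moreover have "(b, hd (ws @ [a])) \<in> F"
    using bw sub dist zs(2) by (auto simp: F_def)
  ultimately have "successively (\<lambda>x y. (x, y) \<in> F) (b # ws @ [a])"
    by (simp add: successively_Cons)
  then have b_a: "(b, a) \<in> F\<^sup>*" using successively_rtrancl[of F b "ws @ [a]"] by simp
  have symF: "sym F" using assms(2) by (auto simp: F_def sym_def)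
  then have "(a, b) \<in> F\<^sup>*" using b_a by (meson symD sym_rtrancl)
  then have "E \<subseteq> F\<^sup>*" using b_a by (auto simp: F_def)
  moreover have "card F + 2 = card E"
  proof -
    have "{(a, b), (b, a)} \<subseteq> E" using ab ba sub by blast
    moreover have "card {(a, b), (b, a)} = 2" using dist by simp
    ultimately show ?thesis
      unfolding F_def using assms(1) by (metis card_Diff_subset card_mono finite.emptyI finite_insert le_add_diff_inverse2)
  qed
  moreover have "F \<subseteq> E" "E - F \<subseteq> cycle_edges zs" using ab ba by (auto simp: F_def)
  ultimately show ?thesis using that symF by blast
qed

lemma is_cycle_after_removal:
  assumes "is_cycle E zs" "E - F \<subseteq> R" "cycle_edges zs \<inter> R = {}"
  shows "is_cycle F zs"
  using assms unfolding is_cycle_def by blast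

text \<open>
  Removing one edge from each of the cycles keeps the graph connected but leaves too few edges for
  that. Disjointness guarantees that the other cycles survive each removal.
\<close>
lemma no_three_disjoint_cycles:
  assumes "finite V" "finite E" "sym E" "r \<in> V" and reach: "\<And>v. v \<in> V \<Longrightarrow> (r, v) \<in> E\<^sup>*"
    and "card E < 2 * card V + 4"
    and c: "is_cycle E xs" "is_cycle E ys" "is_cycle E zs"
    and disj: "cycle_edges xs \<inter> cycle_edges ys = {}" "cycle_edges xs \<inter> cycle_edges zs = {}"
      "cycle_edges ys \<inter> cycle_edges zs = {}"
  shows False
proof -
  obtain F where F: "F \<subseteq> E" "sym F" "E \<subseteq> F\<^sup>*" "card F + 2 = card E" "E - F \<subseteq> cycle_edges xs"
    using remove_cycle_edge[OF assms(2,3) c(1)] .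
  have fF: "finite F" using F(1) assms(2) by (rule finite_subset)
  have cF: "is_cycle F ys" "is_cycle F zs"
    using is_cycle_after_removal[OF c(2) F(5)] is_cycle_after_removal[OF c(3) F(5)] disj by auto
  obtain G where G: "G \<subseteq> F" "sym G" "F \<subseteq> G\<^sup>*" "card G + 2 = card F" "F - G \<subseteq> cycle_edges ys"
    using remove_cycle_edge[OF fF F(2) cF(1)] .
  have fG: "finite G" using G(1) fF by (rule finite_subset)
  have cG: "is_cycle G zs" using is_cycle_after_removal[OF cF(2) G(5)] disj by auto
  obtain H where H: "H \<subseteq> G" "sym H" "G \<subseteq> H\<^sup>*" "card H + 2 = card G"
    using remove_cycle_edge[OF fG G(2) cG] .
  have fH: "finite H" using H(1) fG by (rule finite_subset)
  have "E\<^sup>* \<subseteq> F\<^sup>*" "F\<^sup>* \<subseteq> G\<^sup>*" "G\<^sup>* \<subseteq> H\<^sup>*"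
    using F(3) G(3) H(3) rtrancl_subset_rtrancl by blast+
  then have "(r, v) \<in> H\<^sup>*" if "v \<in> V" for v using reach[OF that] by blast
  then have "2 * (card V - 1) \<le> card H"
    by (rule card_edges_connected[OF assms(1) fH H(2) assms(4)])
  then show False using F(4) G(4) H(4) assms(6) by linarith
qed

section \<open>The determinant as a signed count of edge permutations\<close>

text \<open>
  A term of the Leibniz expansion vanishes unless its permutation moves every index along an edge. The
  bijection between positions in \<open>vs\<close> and vertices preserves signs.
\<close>
lemma det_adjacency_matrix:
  assumes "distinct vs"
  shows "det (adjacency_matrix vs G) = (\<Sum>p\<in>adj_perms (arcs_ends G) (set vs). sign p)"
proof -
  let ?n = "length vs" and ?E = "arcs_ends G"
  let ?I = "{0..<?n}" and ?f = "(!) vs" and ?g = "inv_into {0..<?n} ((!) vs)"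
  define Q where "Q = {p. p permutes ?I \<and> (\<forall>i<?n. (vs ! i, vs ! p i) \<in> ?E)}"
  let ?F = "map_permutation ?I ?f" and ?G = "map_permutation (set vs) ?g"
  have bij: "bij_betw ?f ?I (set vs)"
    using bij_betw_nth[OF assms] by (simp add: atLeast0LessThan)
  then have inj: "inj_on ?f ?I" by (rule bij_betw_imp_inj_on)
  have bij': "bij_betw ?g (set vs) ?I" using bij by (rule bij_betw_inv_into)
  have gf: "?g (vs ! i) = i" if "i < ?n" for i using inj that by simp
  have fg: "vs ! ?g v = v" "?g v < ?n" if "v \<in> set vs" for v
    using that bij_betw_inv_into_right[OF bij] bspec[OF bij_betwE[OF bij']] by simp_all
  have "det (adjacency_matrix vs G) =
      (\<Sum>p | p permutes ?I. sign p * (\<Prod>i = 0..<?n. adjacency_matrix vs G $$ (i, p i)))"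
    by (subst det_def'[where n = ?n]) (auto simp: adjacency_matrix_def)
  also have "\<dots> = (\<Sum>p | p permutes ?I. if p \<in> Q then sign p else 0)"
  proof (rule sum.cong[OF refl])
    fix p assume "p \<in> {p. p permutes ?I}"
    then have p: "p permutes ?I" by simp
    then have "p i < ?n" if "i < ?n" for i using permutes_in_image[OF p, of i] that by simp
    then have "(\<Prod>i = 0..<?n. adjacency_matrix vs G $$ (i, p i)) =
        (\<Prod>i = 0..<?n. if (vs ! i, vs ! p i) \<in> ?E then 1 else 0)"
      by (intro prod.cong) (auto simp: adjacency_matrix_def)
    also have "\<dots> = (if p \<in> Q then 1 else 0)" using p by (auto simp: Q_def)
    finally show "sign p * (\<Prod>i = 0..<?n. adjacency_matrix vs G $$ (i, p i)) =
        (if p \<in> Q then sign p else 0)" by simp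
  qed
  also have "\<dots> = (\<Sum>p\<in>Q. sign p)"
    by (rule sum.mono_neutral_cong_right) (auto simp: Q_def finite_permutations)
  also have "\<dots> = (\<Sum>p\<in>adj_perms ?E (set vs). sign p)"
  proof (rule sum.reindex_bij_witness[where i = ?G and j = ?F])
    fix p assume p: "p \<in> Q"
    then have pp: "p permutes ?I" by (simp add: Q_def)
    show "?G (?F p) = p" using map_permutation_compose_inv[OF bij pp] gf by simp
    have "(v, ?F p v) \<in> ?E" if "v \<in> set vs" for v
    proof -
      have "?F p v = vs ! p (?g v)"
        using map_permutation_apply[OF inj, of "?g v" p] fg[OF that] by simp
      then show ?thesis using p fg[OF that] by (auto simp: Q_def)
    qed
    then show "?F p \<in> adj_perms ?E (set vs)"
      using map_permutation_permutes[OF bij pp] by (simp add: adj_perms_def)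
    show "sign (?F p) = sign p" using sign_map_permutation[OF inj pp] by simp
  next
    fix p assume p: "p \<in> adj_perms ?E (set vs)"
    note pp = adj_permsD(1)[OF p]
    show "?F (?G p) = p" using map_permutation_compose_inv[OF bij' pp] fg(1) by simp
    have "(vs ! i, vs ! ?G p i) \<in> ?E" if i: "i < ?n" for i
    proof -
      have v: "vs ! i \<in> set vs" using i by simp
      have "?G p i = ?g (p (vs ! i))"
        using map_permutation_apply[OF bij_betw_imp_inj_on[OF bij'] v, of p] gf[OF i] by simp
      moreover have "p (vs ! i) \<in> set vs" using v permutes_in_image[OF pp] by simp
      ultimately have "vs ! ?G p i = p (vs ! i)" using fg(1) by simp
      then show ?thesis using adj_permsD(2)[OF p v] by simp
    qed
    then show "?G p \<in> Q" using map_permutation_permutes[OF bij' pp] by (simp add: Q_def)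
  qed
  finally show ?thesis .
qed

section \<open>Subgraphs of a graph as symmetric relations\<close>

text \<open>
  A graph has no parallel arcs, so a subgraph is determined by its vertices and its adjacency
  relation, and this inverts the passage from subgraphs to relations.
\<close>
definition edge_subgraph :: "('a, 'b) pre_digraph \<Rightarrow> 'a set \<Rightarrow> 'a rel \<Rightarrow> ('a, 'b) pre_digraph" where
  "edge_subgraph G W R =
     \<lparr>verts = W, arcs = {a \<in> arcs G. arc_to_ends G a \<in> R}, tail = tail G, head = head G\<rparr>"

lemma arcs_ends_edge_subgraph: "R \<subseteq> arcs_ends G \<Longrightarrow> arcs_ends (edge_subgraph G W R) = R"
  by (auto simp: edge_subgraph_def arcs_ends_def arc_to_ends_def)

lemma graph_edge_subgraph:
  assumes "graph G" "W \<subseteq> verts G" "R \<subseteq> arcs_ends G" "R \<subseteq> W \<times> W" "sym R"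
  shows "graph (edge_subgraph G W R)" "subgraph (edge_subgraph G W R) G"
proof -
  interpret G: graph G by fact
  have wf: "wf_digraph (edge_subgraph G W R)"
    using assms(4) by unfold_locales (auto simp: edge_subgraph_def arc_to_ends_def)
  then show sub: "subgraph (edge_subgraph G W R) G"
    using assms(2) G.wf_digraph by (auto simp: subgraph_def edge_subgraph_def compatible_def)
  have "symmetric (edge_subgraph G W R)"
    using assms(5) by (simp add: symmetric_def arcs_ends_edge_subgraph[OF assms(3)])
  then show "graph (edge_subgraph G W R)"
    by (rule digraph.graphI[OF G.digraph_subgraph[OF sub]])
qed

lemma subgraph_arc_to_ends: "subgraph H G \<Longrightarrow> arc_to_ends H = arc_to_ends G"
  by (auto simp: subgraph_def compatible_def arc_to_ends_def fun_eq_iff)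

lemma subgraph_eq_edge_subgraph:
  assumes "graph G" "subgraph H G"
  shows "H = edge_subgraph G (verts H) (arcs_ends H)"
proof -
  interpret G: graph G by fact
  have "arcs H \<subseteq> arcs G" using assms(2) by (auto simp: subgraph_def)
  then have "{a \<in> arcs G. arc_to_ends G a \<in> arcs_ends H} = arcs H"
    using G.inj_on_arc_to_ends subgraph_arc_to_ends[OF assms(2)]
    by (auto simp: arcs_ends_def inj_on_def)
  moreover have "tail H = tail G" "head H = head G"
    using assms(2) by (auto simp: subgraph_def compatible_def)
  ultimately show ?thesis by (simp add: edge_subgraph_def)
qed

lemma arcs_ends_graph:
  assumes "graph G"
  shows "arcs_ends G \<subseteq> verts G \<times> verts G" "sym (arcs_ends G)" "irrefl (arcs_ends G)"
    "finite (arcs_ends G)" "card (arcs_ends G) = card (arcs G)"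
proof -
  interpret G: graph G by fact
  show "arcs_ends G \<subseteq> verts G \<times> verts G" using G.adj_in_verts by auto
  show "sym (arcs_ends G)" using G.sym_arcs by (simp add: symmetric_def)
  show "irrefl (arcs_ends G)" using G.adj_not_same by (auto simp: irrefl_def)
  show "finite (arcs_ends G)" by (simp add: arcs_ends_def)
  show "card (arcs_ends G) = card (arcs G)"
    unfolding arcs_ends_def by (rule card_image[OF G.inj_on_arc_to_ends])
qed

lemma cycle_of_is_cycle:
  assumes "cycle_of G C"
  obtains xs where "is_cycle (arcs_ends G) xs" "verts C = set xs" "arcs_ends C = cycle_edges xs"
proof -
  from assms obtain xs where "distinct xs" "3 \<le> length xs" "verts C = set xs" "arcs_ends C = cycle_edges xs"
    unfolding cycle_of_def cycle_graph_def cycle_edges_def by blast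
  moreover have "arcs_ends C \<subseteq> arcs_ends G"
    using assms by (auto simp: cycle_of_def dest: arcs_ends_mono)
  ultimately show ?thesis using that by (simp add: is_cycle_def)
qed

lemma is_cycle_cycle_of:
  assumes "graph G" "is_cycle (arcs_ends G) xs"
  shows "cycle_of G (edge_subgraph G (set xs) (cycle_edges xs))"
    "arcs_ends (edge_subgraph G (set xs) (cycle_edges xs)) = cycle_edges xs"
proof -
  let ?C = "edge_subgraph G (set xs) (cycle_edges xs)"
  have sub: "cycle_edges xs \<subseteq> arcs_ends G" using assms(2) by (simp add: is_cycle_def)
  have W: "cycle_edges xs \<subseteq> set xs \<times> set xs"
    using FieldI1 FieldI2 unfolding Field_cycle_edges[symmetric] by fast
  have "Field (cycle_edges xs) \<subseteq> verts G"
    using sub arcs_ends_graph(1)[OF assms(1)] by (auto simp: Field_def)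
  then have "set xs \<subseteq> verts G" by (simp add: Field_cycle_edges)
  note C = graph_edge_subgraph[OF assms(1) this sub W sym_cycle_edges]
  show ends: "arcs_ends ?C = cycle_edges xs" by (rule arcs_ends_edge_subgraph[OF sub])
  have "cycle_graph ?C"
    using C(1) assms(2) ends
    by (auto simp: cycle_graph_def edge_subgraph_def is_cycle_def cycle_edges_def)
  then show "cycle_of G ?C" using C(2) by (simp add: cycle_of_def)
qed

lemma disjoint_arcs_ends:
  assumes "graph G" "subgraph C G" "subgraph D G" "arcs C \<inter> arcs D = {}"
  shows "arcs_ends C \<inter> arcs_ends D = {}"
proof -
  interpret G: graph G by fact
  have "arcs C \<subseteq> arcs G" "arcs D \<subseteq> arcs G" using assms(2,3) by (auto simp: subgraph_def)
  then have "arc_to_ends G ` arcs C \<inter> arc_to_ends G ` arcs D = arc_to_ends G ` (arcs C \<inter> arcs D)"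
    using inj_on_image_Int[OF G.inj_on_arc_to_ends] by metis
  then show ?thesis
    using assms(4) subgraph_arc_to_ends[OF assms(2)] subgraph_arc_to_ends[OF assms(3)]
    by (simp add: arcs_ends_def)
qed

section \<open>Perfect matchings as involutions\<close>

definition matching_graph :: "('a, 'b) pre_digraph \<Rightarrow> ('a \<Rightarrow> 'a) \<Rightarrow> ('a, 'b) pre_digraph" where
  "matching_graph G N = edge_subgraph G (verts G) {(v, N v) | v. v \<in> verts G}"

lemma arcs_ends_induce_subgraph: "arcs_ends (G \<restriction> S) = arcs_ends G \<inter> S \<times> S"
  by (auto simp: arcs_ends_def arc_to_ends_def)

lemma graph_induce_subgraph:
  assumes "graph G" "S \<subseteq> verts G"
  shows "graph (G \<restriction> S)"
proof -
  interpret G: graph G by fact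
  have ind: "induced_subgraph (G \<restriction> S) G" using assms(2) by (rule G.induced_induce)
  show ?thesis
    using digraph.graphI[OF G.digraph_subgraph[OF induced_imp_subgraph[OF ind]]]
      induced_graph_imp_symmetric[OF G.sym_arcs ind] by blast
qed

text \<open>
  A component that is a single edge gives its two vertices one neighbour each. Conversely,
  if all vertices have a unique neighbour, then nothing but \<open>v\<close> and its neighbour can be
  reached from \<open>v\<close>.
\<close>
lemma components_K2_iff:
  assumes "graph M"
  shows "(\<forall>C\<in>pre_digraph.sccs M. complete_digraph 2 C) \<longleftrightarrow>
    (\<forall>v\<in>verts M. \<exists>!w. (v, w) \<in> arcs_ends M)"
proof -
  interpret M: graph M by fact
  have sccs: "pre_digraph.sccs M = (\<lambda>v. M \<restriction> M.scc_of v) ` verts M"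
    using M.sccs_conv_sccs_verts M.sccs_verts_conv_scc_of by (simp add: image_image)
  have scc: "w \<in> M.scc_of v \<longleftrightarrow> v \<rightarrow>\<^sup>*\<^bsub>M\<^esub> w" for v w
    using M.symmetric_reachable'[of v w] by (auto simp: M.scc_of_def)
  have sym: "(w, v) \<in> arcs_ends M" if "(v, w) \<in> arcs_ends M" for v w
    using symD[OF arcs_ends_graph(2)[OF assms] that] .
  show ?thesis unfolding sccs ball_simps
  proof (intro iffI ballI)
    fix v assume K2: "\<forall>v\<in>verts M. complete_digraph 2 (M \<restriction> M.scc_of v)" and v: "v \<in> verts M"
    then have "complete_digraph 2 (M \<restriction> M.scc_of v)" by blast
    then have card: "card (M.scc_of v) = 2"
      and ends: "arcs_ends (M \<restriction> M.scc_of v) = {(a, b). (a, b) \<in> M.scc_of v \<times> M.scc_of v \<and> a \<noteq> b}"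
      by (simp_all add: complete_digraph_def)
    have self: "v \<in> M.scc_of v" using v by (rule M.in_scc_of_self)
    then have "card (M.scc_of v - {v}) = 1" using card by simp
    then obtain w where "M.scc_of v - {v} = {w}" by (rule card_1_singletonE)
    then have w: "M.scc_of v = {v, w}" "w \<noteq> v" using self by auto
    then have "(v, w) \<in> arcs_ends (M \<restriction> M.scc_of v)" unfolding ends by auto
    then have vw: "(v, w) \<in> arcs_ends M" by (rule dominates_induce_subgraphD)
    show "\<exists>!w. (v, w) \<in> arcs_ends M"
    proof (rule ex1I[where a = w])
      show "(v, w) \<in> arcs_ends M" by fact
      fix x assume x: "(v, x) \<in> arcs_ends M"
      then have "x \<in> M.scc_of v" by (simp add: scc)
      moreover have "x \<noteq> v" using M.adj_not_same x by blast
      ultimately show "x = w" using w by simp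
    qed
  next
    fix v assume uniq: "\<forall>v\<in>verts M. \<exists>!w. (v, w) \<in> arcs_ends M" and v: "v \<in> verts M"
    from ex1_implies_ex[OF bspec[OF uniq v]] obtain w where vw: "(v, w) \<in> arcs_ends M" ..
    note wv = sym[OF vw]
    have w: "w \<in> verts M" by (rule M.adj_in_verts(2)[OF vw])
    have wne: "w \<noteq> v" using vw M.adj_not_same by blast
    have nb: "x = w" if "(v, x) \<in> arcs_ends M" for x using ex1E[OF bspec[OF uniq v]] that vw by metis
    have nb': "x = v" if "(w, x) \<in> arcs_ends M" for x using ex1E[OF bspec[OF uniq w]] that wv by metis
    have closed: "x \<in> {v, w}" if "v \<rightarrow>\<^sup>*\<^bsub>M\<^esub> x" for x
      using that
    proof (induction rule: M.reachable_induct)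
      case (step x y)
      then show ?case using nb[of y] nb'[of y] by blast
    qed simp
    have "M.scc_of v \<subseteq> {v, w}" using closed scc by blast
    moreover have "{v, w} \<subseteq> M.scc_of v" using v vw by (simp add: scc)
    ultimately have scc_v: "M.scc_of v = {v, w}" by (rule equalityI)
    have "graph (M \<restriction> {v, w})" using v w by (intro graph_induce_subgraph[OF assms]) simp
    moreover have "arcs_ends (M \<restriction> {v, w}) = {(a, b). (a, b) \<in> {v, w} \<times> {v, w} \<and> a \<noteq> b}"
      unfolding arcs_ends_induce_subgraph using vw wv M.adj_not_same by auto
    ultimately show "complete_digraph 2 (M \<restriction> M.scc_of v)"
      using wne by (simp add: complete_digraph_def scc_v)
  qed
qed

lemma matching_graph:
  assumes "graph G" "N \<in> matchings (arcs_ends G) (verts G)"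
  shows "arcs_ends (matching_graph G N) = {(v, N v) | v. v \<in> verts G}"
    and "perfect_matching G (matching_graph G N)"
proof -
  let ?R = "{(v, N v) | v. v \<in> verts G}" and ?M = "matching_graph G N"
  note ND = matchingsD[OF assms(2)]
  have R: "?R \<subseteq> arcs_ends G" "?R \<subseteq> verts G \<times> verts G" using ND(3,5) by auto
  have "sym ?R" using ND(4,5) by (auto simp: sym_def)
  note M = graph_edge_subgraph[OF assms(1) subset_refl R this, folded matching_graph_def]
  show ends: "arcs_ends ?M = ?R"
    unfolding matching_graph_def by (rule arcs_ends_edge_subgraph[OF R(1)])
  have verts: "verts ?M = verts G" by (simp add: matching_graph_def edge_subgraph_def)
  have "\<forall>v\<in>verts ?M. \<exists>!w. (v, w) \<in> arcs_ends ?M" unfolding ends verts by blast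
  then show "perfect_matching G ?M"
    using M verts components_K2_iff[OF M(1)] by (simp add: perfect_matching_def spanning_def)
qed

lemma perfect_matchings_bij:
  assumes "graph G"
  shows "bij_betw (matching_graph G) (matchings (arcs_ends G) (verts G)) {M. perfect_matching G M}"
  unfolding bij_betw_def
proof (intro conjI inj_onI equalityI subsetI)
  fix N K assume N: "N \<in> matchings (arcs_ends G) (verts G)" and K: "K \<in> matchings (arcs_ends G) (verts G)"
    and eq: "matching_graph G N = matching_graph G K"
  have R: "{(v, N v) | v. v \<in> verts G} = {(v, K v) | v. v \<in> verts G}"
    using matching_graph(1)[OF assms N] matching_graph(1)[OF assms K] eq by simp
  show "N = K"
  proof
    fix v show "N v = K v"
    proof (cases "v \<in> verts G")
      case True
      then have "(v, N v) \<in> {(v, K v) | v. v \<in> verts G}" unfolding R[symmetric] by blast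
      then show ?thesis by blast
    next
      case False
      then show ?thesis
        using permutes_not_in[OF matchingsD(2)[OF N]] permutes_not_in[OF matchingsD(2)[OF K]] by simp
    qed
  qed
next
  fix M assume "M \<in> matching_graph G ` matchings (arcs_ends G) (verts G)"
  then show "M \<in> {M. perfect_matching G M}" using matching_graph(2)[OF assms] by auto
next
  fix M assume "M \<in> {M. perfect_matching G M}"
  then have M: "graph M" "subgraph M G" "verts M = verts G"
    and uniq: "\<forall>v\<in>verts G. \<exists>!w. (v, w) \<in> arcs_ends M"
    using components_K2_iff[of M] by (auto simp: perfect_matching_def spanning_def)
  define N where "N v = (if v \<in> verts G then THE w. (v, w) \<in> arcs_ends M else v)" for v
  have N: "(v, w) \<in> arcs_ends M \<longleftrightarrow> w = N v" if "v \<in> verts G" for v w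
  proof -
    have "\<exists>!w. (v, w) \<in> arcs_ends M" using uniq that by blast
    then have "(v, N v) \<in> arcs_ends M" using theI' that unfolding N_def by simp
    then show ?thesis using uniq that by blast
  qed
  note ends = arcs_ends_graph[OF M(1)]
  have "N \<in> matchings (arcs_ends G) (verts G)"
  proof (rule matchingsI)
    fix v assume v: "v \<in> verts G"
    then have e: "(v, N v) \<in> arcs_ends M" using N by simp
    then have Nv: "N v \<in> verts G" using ends(1) M(3) by blast
    have "(N v, v) \<in> arcs_ends M" using ends(2) e by (rule symD)
    then have "N (N v) = v" using N[OF Nv] by simp
    moreover have "(v, N v) \<in> arcs_ends G" using arcs_ends_mono[OF M(2)] e by blast
    ultimately show "N v \<in> verts G \<and> (v, N v) \<in> arcs_ends G \<and> N (N v) = v" using Nv by simp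
  qed (simp add: N_def)
  moreover have "arcs_ends M = {(v, N v) | v. v \<in> verts G}"
  proof (intro equalityI subrelI)
    fix v w assume vw: "(v, w) \<in> arcs_ends M"
    then have v: "v \<in> verts G" using ends(1) M(3) by blast
    then have "w = N v" using N vw by simp
    then show "(v, w) \<in> {(v, N v) | v. v \<in> verts G}" using v by blast
  next
    fix v w assume "(v, w) \<in> {(v, N v) | v. v \<in> verts G}"
    then show "(v, w) \<in> arcs_ends M" using N by blast
  qed
  then have "M = matching_graph G N"
    using subgraph_eq_edge_subgraph[OF assms M(2)] M(3) by (simp add: matching_graph_def)
  ultimately show "M \<in> matching_graph G ` matchings (arcs_ends G) (verts G)" by blast
qed

lemma unique_perfect_matching_iff:
  assumes "graph G"
  shows "(\<exists>!M. perfect_matching G M) \<longleftrightarrow> card (matchings (arcs_ends G) (verts G)) = 1"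
proof -
  have "card (matchings (arcs_ends G) (verts G)) = card {M. perfect_matching G M}"
    using perfect_matchings_bij[OF assms] by (rule bij_betw_same_card)
  moreover have "card {M. perfect_matching G M} = 1 \<longleftrightarrow> (\<exists>!M. perfect_matching G M)"
    by (auto simp: card_1_singleton_iff set_eq_iff)
  ultimately show ?thesis by simp
qed

lemma matchings_induce_subgraph:
  "matchings (arcs_ends (G \<restriction> S)) S = matchings (arcs_ends G) S"
proof -
  have "p v \<in> S" if "p permutes S" "v \<in> S" for p v using that by (simp add: permutes_in_image)
  then have "adj_perms (arcs_ends (G \<restriction> S)) S = adj_perms (arcs_ends G) S"
    by (auto simp: adj_perms_def arcs_ends_induce_subgraph)
  then show ?thesis by (simp add: matchings_def)
qed

lemma ex_perfect_matching_induce_subgraph_iff: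
  assumes "graph G" "S \<subseteq> verts G"
  shows "(\<exists>M. perfect_matching (G \<restriction> S) M) \<longleftrightarrow> matchings (arcs_ends G) S \<noteq> {}"
proof -
  have "matching_graph (G \<restriction> S) ` matchings (arcs_ends G) S = {M. perfect_matching (G \<restriction> S) M}"
    using perfect_matchings_bij[OF graph_induce_subgraph[OF assms]]
    by (simp add: bij_betw_def matchings_induce_subgraph)
  then show ?thesis by blast
qed

section \<open>Unimodular bicyclic graphs\<close>

text \<open>
  A third cycle would be edge-disjoint from the two given ones, which contradicts
  the number of edges.
\<close>
lemma infinity_type_two_cycles:
  assumes inf: "infinity_type B" and C: "cycle_of B \<Gamma>" and D: "cycle_of B \<Gamma>'" and ne: "\<Gamma> \<noteq> \<Gamma>'"
    and xs: "is_cycle (arcs_ends B) xs" "arcs_ends \<Gamma> = cycle_edges xs"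
    and ys: "is_cycle (arcs_ends B) ys" "arcs_ends \<Gamma>' = cycle_edges ys"
  shows "two_cycles (verts B) (arcs_ends B) xs ys"
proof -
  have bi: "graph B" "connected B" "num_edges B = card (verts B) + 1"
    and disj: "\<And>C D. cycle_of B C \<Longrightarrow> cycle_of B D \<Longrightarrow> C \<noteq> D \<Longrightarrow> arcs C \<inter> arcs D = {}"
    using inf by (auto simp: infinity_type_def bicyclic_def)
  interpret B: graph B by fact
  note E = arcs_ends_graph[OF bi(1)]
  have disj': "arcs_ends C \<inter> arcs_ends D = {}" if "cycle_of B C" "cycle_of B D" "C \<noteq> D" for C D
    using disjoint_arcs_ends[OF bi(1) _ _ disj[OF that]] that by (simp add: cycle_of_def)
  have xy: "cycle_edges xs \<inter> cycle_edges ys = {}"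
    using disj'[OF C D ne] xs(2) ys(2) by simp
  have sc: "strongly_connected B"
    using B.symmetric_connected_imp_strongly_connected[OF B.sym_arcs bi(2)] .
  then obtain r where r: "r \<in> verts B" by (auto simp: strongly_connected_def)
  have reach: "(r, v) \<in> (arcs_ends B)\<^sup>*" if "v \<in> verts B" for v
    using sc r that reachable_rtranclI by (metis strongly_connected_def)
  have card: "card (arcs_ends B) < 2 * card (verts B) + 4"
    using bi(3) E(5) by (simp add: num_edges_def)
  show ?thesis
  proof
    fix zs assume zs: "is_cycle (arcs_ends B) zs"
    let ?C = "edge_subgraph B (set zs) (cycle_edges zs)"
    note Z = is_cycle_cycle_of[OF bi(1) zs]
    show "cycle_edges zs \<in> {cycle_edges xs, cycle_edges ys}"
    proof (rule ccontr)
      assume "cycle_edges zs \<notin> {cycle_edges xs, cycle_edges ys}"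
      then have "\<Gamma> \<noteq> ?C" "\<Gamma>' \<noteq> ?C" using Z(2) xs(2) ys(2) by auto
      then have "cycle_edges xs \<inter> cycle_edges zs = {}" "cycle_edges ys \<inter> cycle_edges zs = {}"
        using disj'[OF C Z(1)] disj'[OF D Z(1)] Z(2) xs(2) ys(2) by simp_all
      then show False
        using no_three_disjoint_cycles[OF B.finite_verts E(4,2) r reach card xs(1) ys(1) zs xy] by simp
    qed
  qed (use E xs(1) ys(1) xy in auto)
qed

theorem theorem12:
  fixes B \<Gamma> \<Gamma>' :: "('a, 'b) pre_digraph" and vs :: "'a list"
  assumes "infinity_type B"
    and "cycle_of B \<Gamma>" and "cycle_of B \<Gamma>'" and "\<Gamma> \<noteq> \<Gamma>'"
    and "distinct vs" and "set vs = verts B"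
  shows "unimodular vs B \<longleftrightarrow>
    (\<exists>!M. perfect_matching B M) \<and>
    (\<not> empty_graph (graph_minus B (union \<Gamma> \<Gamma>')) \<and>
     \<not> (\<exists>M. perfect_matching (graph_minus B (union \<Gamma> \<Gamma>')) M))"
proof -
  have B: "graph B" using assms(1) by (simp add: infinity_type_def bicyclic_def)
  obtain xs where xs: "is_cycle (arcs_ends B) xs" "verts \<Gamma> = set xs" "arcs_ends \<Gamma> = cycle_edges xs"
    using cycle_of_is_cycle[OF assms(2)] .
  obtain ys where ys: "is_cycle (arcs_ends B) ys" "verts \<Gamma>' = set ys" "arcs_ends \<Gamma>' = cycle_edges ys"
    using cycle_of_is_cycle[OF assms(3)] .
  interpret two_cycles "verts B" "arcs_ends B" xs ys
    by (rule infinity_type_two_cycles[OF assms(1-4) xs(1,3) ys(1,3)])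
  let ?W = "verts B - (set xs \<union> set ys)"
  have rest: "graph_minus B (union \<Gamma> \<Gamma>') = B \<restriction> ?W"
    by (simp add: graph_minus_def union_def xs(2) ys(2))
  have "unimodular vs B \<longleftrightarrow> (\<Sum>p\<in>adj_perms (arcs_ends B) (verts B). sign p) \<in> {-1, 1}"
    unfolding unimodular_def det_adjacency_matrix[OF assms(5)] assms(6) ..
  also have "\<dots> \<longleftrightarrow> (\<exists>!M. perfect_matching B M) \<and> \<not> (\<exists>M. perfect_matching (B \<restriction> ?W) M)"
    unfolding sum_sign_unit_iff unique_perfect_matching_iff[OF B]
    using ex_perfect_matching_induce_subgraph_iff[OF B, of ?W] by blast
  finally have iff: "unimodular vs B \<longleftrightarrow>
    (\<exists>!M. perfect_matching B M) \<and> \<not> (\<exists>M. perfect_matching (B \<restriction> ?W) M)" .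
  have "\<exists>M. perfect_matching (B \<restriction> ?W) M" if "empty_graph (B \<restriction> ?W)"
  proof -
    have W: "?W = {}" using that by (simp add: empty_graph_def)
    have "id \<in> matchings (arcs_ends B) {}" by (rule matchingsI) auto
    then have "matchings (arcs_ends B) ?W \<noteq> {}" unfolding W by blast
    then show ?thesis using ex_perfect_matching_induce_subgraph_iff[OF B, of ?W] by blast
  qed
  then show ?thesis unfolding rest using iff by blast
qed

end
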